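(* Let $X$ be a connected graph on $n$ vertices. Then the minimal multiplicity bipartition of $X$ is $[n-2,2]$ if and only if \[ X = (K_{a_1} \cup K_{b_1}) \triangledown (K_{a_2} \cup K_{b_2}) \triangledown \cdots \triangledown (K_{a_k} \cup K_{b_k}) \] for some integer $k>1$ and non-negative integers $a_1,\dots,a_k$ and $b_1,\dots,b_k$, where $X$ is not isomorphic to a complete graph, and $X$ is not isomorphic to a graph of the form $(K_{a} \cup K_{b}) \triangledown K_1$.
   Context: All graphs are simple and finite. $K_m$ denotes the complete graph on $m$ vertices ($K_0$ is the graph with no vertices), and $\cup$ denotes disjoint union. For graphs $X$ and $Y$, the join $X \triangledown Y$ is the graph with vertex set $V(X)\cup V(Y)$ (disjoint) and edge set $E(X)\cup E(Y)\cup\{\{x,y\}: x\in V(X), y\in V(Y)\}$. For a graph $X$ with vertex set $\{1,\dots,n\}$, $S(X)$ is the set of real symmetric $n\times n$ matrices $A$ such that for $i\neq j$, $a_{ij}\neq 0$ if and only if $\{i,j\}\in E(X)$ (diagonal entries are unrestricted). For $1\le i\le n-1$, $[n-i,i]$ is a multiplicity bipartition of $X$ if there exists $A\in S(X)$ with exactly two distinct eigenvalues $\lambda_1\neq\lambda_2$, of multiplicities $n-i$ and $i$ respectively. The minimal multiplicity bipartition of $X$ is $[n-i,i]$ where $i$ is the least value for which $[n-i,i]$ is a multiplicity bipartition of $X$. *)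

theory Defs
  imports
    "Graph_Theory.Graph_Theory"
    "Jordan_Normal_Form.Char_Poly"
begin

text \<open>
  Finite simple graphs are rendered by the locale \<open>pair_graph\<close>: an edge \<open>{u, v}\<close> is the pair of
  arcs \<open>(u, v)\<close>, \<open>(v, u)\<close>.
\<close>

abbreviation graph_iso :: "'a pair_pre_digraph \<Rightarrow> 'b pair_pre_digraph \<Rightarrow> bool" where
  "graph_iso X Y \<equiv> digraph_iso (with_proj X) (with_proj Y)"

definition complete_graph :: "nat \<Rightarrow> nat pair_pre_digraph" where
  "complete_graph m =
     \<lparr>pverts = {0..<m}, parcs = {(u, v). u \<in> {0..<m} \<and> v \<in> {0..<m} \<and> u \<noteq> v}\<rparr>"

definition graph_union ::
  "'a pair_pre_digraph \<Rightarrow> 'b pair_pre_digraph \<Rightarrow> ('a + 'b) pair_pre_digraph" where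
  "graph_union X Y =
     \<lparr>pverts = Inl ` pverts X \<union> Inr ` pverts Y,
      parcs = map_prod Inl Inl ` parcs X \<union> map_prod Inr Inr ` parcs Y\<rparr>"

definition graph_join ::
  "'a pair_pre_digraph \<Rightarrow> 'b pair_pre_digraph \<Rightarrow> ('a + 'b) pair_pre_digraph" where
  "graph_join X Y =
     \<lparr>pverts = Inl ` pverts X \<union> Inr ` pverts Y,
      parcs = map_prod Inl Inl ` parcs X \<union> map_prod Inr Inr ` parcs Y
        \<union> (Inl ` pverts X) \<times> (Inr ` pverts Y) \<union> (Inr ` pverts Y) \<times> (Inl ` pverts X)\<rparr>"

text \<open>
  The iterated join of \<open>F 0, \<dots>, F (k - 1)\<close>. Iterating the binary join would change the vertex type
  at every step, so the vertices of \<open>F i\<close> are tagged with \<open>i\<close> instead; \<open>graph_joins_0\<close>,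
  \<open>graph_joins_1\<close> and \<open>graph_joins_Suc\<close> below show that, up to isomorphism, this is the iterated
  binary join.
\<close>

definition graph_joins ::
  "nat \<Rightarrow> (nat \<Rightarrow> 'a pair_pre_digraph) \<Rightarrow> (nat \<times> 'a) pair_pre_digraph" where
  "graph_joins k F =
     \<lparr>pverts = (SIGMA i:{0..<k}. pverts (F i)),
      parcs = {((i, u), (j, v)) | i u j v.
        i < k \<and> j < k \<and> u \<in> pverts (F i) \<and> v \<in> pverts (F j) \<and>
        (i = j \<longrightarrow> (u, v) \<in> parcs (F i))}\<rparr>"

text \<open>
  The set \<open>S(X)\<close>, for a graph with vertex set \<open>{0..<n}\<close> (matrix indices start at 0).
\<close>

definition graph_matrices :: "nat pair_pre_digraph \<Rightarrow> real mat set" where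
  "graph_matrices X =
     {A. let n = card (pverts X) in
       A \<in> carrier_mat n n \<and> transpose_mat A = A \<and>
       (\<forall>i<n. \<forall>j<n. i \<noteq> j \<longrightarrow> (A $$ (i, j) \<noteq> 0 \<longleftrightarrow> (i, j) \<in> parcs X))}"

text \<open>\<open>multiplicity_bipartition X p i\<close> reads: \<open>[p, i]\<close> is a multiplicity bipartition of \<open>X\<close>.\<close>

definition multiplicity_bipartition :: "nat pair_pre_digraph \<Rightarrow> nat \<Rightarrow> nat \<Rightarrow> bool" where
  "multiplicity_bipartition X p i \<longleftrightarrow>
     1 \<le> i \<and> i \<le> card (pverts X) - 1 \<and> p = card (pverts X) - i \<and>
     (\<exists>A \<in> graph_matrices X. \<exists>l1 l2. l1 \<noteq> l2 \<and> {l. eigenvalue A l} = {l1, l2} \<and>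
        Polynomial.order l1 (char_poly A) = p \<and> Polynomial.order l2 (char_poly A) = i)"

definition minimal_multiplicity_bipartition :: "nat pair_pre_digraph \<Rightarrow> nat \<Rightarrow> nat \<Rightarrow> bool" where
  "minimal_multiplicity_bipartition X p i \<longleftrightarrow>
     multiplicity_bipartition X p i \<and>
     (\<forall>q j. multiplicity_bipartition X q j \<longrightarrow> i \<le> j)"

lemma graph_isoI:
  assumes "pair_wf_digraph X" "inj_on f (pverts X)" "pverts Y = f ` pverts X"
    and "parcs Y = map_prod f f ` parcs X"
  shows "graph_iso X Y"
proof -
  interpret pair_wf_digraph X by fact
  let ?h = "\<lparr>iso_verts = f, iso_arcs = map_prod f f, iso_head = snd, iso_tail = fst\<rparr>"
  have "parcs X \<subseteq> pverts X \<times> pverts X"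
    using wellformed' by auto
  then have "inj_on (map_prod f f) (parcs X)"
    using inj_on_subset map_prod_inj_on[OF assms(2) assms(2)] by blast
  then have "pre_digraph.digraph_isomorphism (with_proj X) ?h"
    using assms(1,2) by (auto simp: pre_digraph.digraph_isomorphism_def wf_digraph_wp_iff)
  moreover have "with_proj Y = app_iso ?h (with_proj X)"
    using assms(3,4) by (simp add: app_iso_def with_proj_def)
  ultimately show ?thesis
    unfolding digraph_iso_def by blast
qed

lemma complete_digraph_complete_graph: "complete_digraph m (with_proj (complete_graph m))"
  unfolding complete_digraph_pair_def complete_graph_def by auto

lemma pair_wf_digraph_graph_joins: "pair_wf_digraph (graph_joins k F)"
  by unfold_locales (auto simp: graph_joins_def)

lemma pverts_graph_joins: "(i, u) \<in> pverts (graph_joins k F) \<longleftrightarrow> i < k \<and> u \<in> pverts (F i)"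
  by (simp add: graph_joins_def)

lemma parcs_graph_joins:
  "((i, u), (j, v)) \<in> parcs (graph_joins k F) \<longleftrightarrow>
     i < k \<and> j < k \<and> u \<in> pverts (F i) \<and> v \<in> pverts (F j) \<and> (i = j \<longrightarrow> (u, v) \<in> parcs (F i))"
  by (simp add: graph_joins_def)

lemma parcs_graph_join:
  "(Inl u, Inl u') \<in> parcs (graph_join X Y) \<longleftrightarrow> (u, u') \<in> parcs X"
  "(Inr v, Inr v') \<in> parcs (graph_join X Y) \<longleftrightarrow> (v, v') \<in> parcs Y"
  "(Inl u, Inr v) \<in> parcs (graph_join X Y) \<longleftrightarrow> u \<in> pverts X \<and> v \<in> pverts Y"
  "(Inr v, Inl u) \<in> parcs (graph_join X Y) \<longleftrightarrow> u \<in> pverts X \<and> v \<in> pverts Y"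
  by (auto simp: graph_join_def intro: rev_image_eqI)

lemma graph_joins_0: "pverts (graph_joins 0 F) = {}"
  by (simp add: graph_joins_def)

lemma graph_joins_1:
  assumes "pair_wf_digraph (F 0)"
  shows "graph_iso (graph_joins 1 F) (F 0)"
proof (rule graph_isoI[OF pair_wf_digraph_graph_joins, where f = snd])
  interpret pair_wf_digraph "F 0" by fact
  show "inj_on snd (pverts (graph_joins 1 F))"
    by (auto simp: graph_joins_def inj_on_def)
  show "pverts (F 0) = snd ` pverts (graph_joins 1 F)"
    by (force simp: graph_joins_def)
  show "parcs (F 0) = map_prod snd snd ` parcs (graph_joins 1 F)"
    using wellformed'
    by (auto simp: parcs_graph_joins intro: image_eqI[where x = "((0, _), (0, _))"])
qed

lemma graph_joins_Suc:
  assumes "pair_wf_digraph (F k)"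
  shows "graph_iso (graph_joins (Suc k) F) (graph_join (graph_joins k F) (F k))"
proof (rule graph_isoI[OF pair_wf_digraph_graph_joins,
      where f = "\<lambda>(i, u). if i = k then Inr u else Inl (i, u)"])
  let ?f = "\<lambda>(i, u). if i = k then Inr u else Inl (i, u)"
  let ?J = "graph_joins (Suc k) F"
  let ?R = "graph_join (graph_joins k F) (F k)"
  interpret pair_wf_digraph "F k" by fact
  show "inj_on ?f (pverts ?J)"
    by (auto simp: inj_on_def split: if_splits)
  show "pverts ?R = ?f ` pverts ?J"
    by (fastforce simp: graph_joins_def graph_join_def image_iff less_Suc_eq split: if_splits)
  show "parcs ?R = map_prod ?f ?f ` parcs ?J"
  proof
    show "map_prod ?f ?f ` parcs ?J \<subseteq> parcs ?R"
      by (rule image_subsetI)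
        (auto simp: parcs_graph_joins parcs_graph_join pverts_graph_joins less_Suc_eq)
    show "parcs ?R \<subseteq> map_prod ?f ?f ` parcs ?J"
    proof
      fix e assume e: "e \<in> parcs ?R"
      let ?g = "case_sum id (Pair k)"
      have "map_prod ?g ?g e \<in> parcs ?J" and eq: "map_prod ?f ?f (map_prod ?g ?g e) = e"
        using e wellformed'
        by (cases e; cases "fst e"; cases "snd e";
            auto simp: parcs_graph_joins parcs_graph_join pverts_graph_joins less_Suc_eq)+
      then show "e \<in> map_prod ?f ?f ` parcs ?J"
        by (intro image_eqI[where x = "map_prod ?g ?g e"]) simp_all
    qed
  qed
qed

end

theory Submission
  imports Defs "Jordan_Normal_Form.Schur_Decomposition"
begin

text \<open>
  Up to an affine change, a matrix in \<open>S(X)\<close> with two eigenvalues is a multiple of an orthogonal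
  projection of rank \<open>i\<close>, that is, the Gram matrix of vectors in \<open>\<real>\<^sup>i\<close>, one for each vertex, that form
  a tight frame; distinct vertices are adjacent iff their vectors are not orthogonal.
  For \<open>i = 1\<close> a connected graph must be complete. For \<open>i = 2\<close>, being parallel or perpendicular
  partitions the nonzero vectors of the plane, and each class induces \<open>K\<^sub>a \<union> K\<^sub>b\<close>, so that \<open>X\<close> is a
  join of such graphs. Conversely, given a join, tightness has to be arranged. In terms of the
  doubled angles it says that certain weighted unit vectors, one for each block, sum to zero. A block
  with two nonempty sides may have any real weight, a dominating vertex only a positive one, and so
  a single dominating vertex next to a single proper block is the only obstruction.
\<close>

section \<open>Symmetric matrices with two eigenvalues\<close>

text \<open>The multiplicities are orders of roots of \<open>char_poly\<close>, so diagonalisability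
  has to be won first: a real triangular form and a trace argument give
  \<open>(A - a)(A - b) = 0\<close>, and the rank of the projection is read off as its trace. Angles
  never appear. A line of slope \<open>\<tau>\<close> has doubled direction proportional to
  \<open>(1 - \<tau>^2, 2 \<tau>)\<close>, and the perpendicular line has the opposite one; swapping
  the sides of a block negates its weight, so weights may be taken nonnegative. Opposite doubled
  directions come from perpendicular lines, hence from one block, so a balance with some nonzero
  weight involves at least three slopes. Slopes of distinct blocks must also avoid product -1, which
  would create nonadjacency across blocks. Dominating vertices are pairwise adjacent, so they may
  share a slope or be spread over several; this is how two of them make up for a missing second
  proper block.\<close>

lemma mat_trace_mult_comm:
  fixes A B :: "'a :: comm_semiring_0 mat"
  assumes "A \<in> carrier_mat n m" "B \<in> carrier_mat m n"
  shows "(\<Sum>i<n. (A * B) $$ (i, i)) = (\<Sum>i<m. (B * A) $$ (i, i))"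
proof -
  have "(\<Sum>i<n. (A * B) $$ (i, i)) = (\<Sum>i<n. \<Sum>j<m. A $$ (i, j) * B $$ (j, i))"
    using assms by (intro sum.cong) (auto simp: scalar_prod_def atLeast0LessThan)
  also have "\<dots> = (\<Sum>j<m. \<Sum>i<n. B $$ (j, i) * A $$ (i, j))"
    by (subst sum.swap) (simp add: mult.commute)
  also have "\<dots> = (\<Sum>j<m. (B * A) $$ (j, j))"
    using assms by (intro sum.cong) (auto simp: scalar_prod_def atLeast0LessThan)
  finally show ?thesis .
qed

lemma mat_trace_similar:
  fixes A B :: "'a :: comm_semiring_1 mat"
  assumes "A \<in> carrier_mat n n" "similar_mat_wit A B P Q"
  shows "(\<Sum>i<n. A $$ (i, i)) = (\<Sum>i<n. B $$ (i, i))"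
proof -
  note w = similar_mat_witD2[OF assms]
  have "A = P * (B * Q)"
    using w(3) assoc_mult_mat[OF w(6,5,7)] by (rule trans)
  then have "(\<Sum>i<n. A $$ (i, i)) = (\<Sum>i<n. (P * (B * Q)) $$ (i, i))"
    by (rule arg_cong)
  also have "\<dots> = (\<Sum>i<n. ((B * Q) * P) $$ (i, i))"
    by (rule mat_trace_mult_comm) (use w in auto)
  also have "(B * Q) * P = B"
    using assoc_mult_mat[OF w(5,7,6)] w(2,5) by simp
  finally show ?thesis .
qed

lemma upper_triangular_mult:
  fixes A B :: "'a :: semiring_0 mat"
  assumes "A \<in> carrier_mat n n" "B \<in> carrier_mat n n" "upper_triangular A" "upper_triangular B"
  shows "upper_triangular (A * B)"
    and "i < n \<Longrightarrow> (A * B) $$ (i, i) = A $$ (i, i) * B $$ (i, i)"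
proof -
  have ent: "(A * B) $$ (i, j) = (\<Sum>k<n. A $$ (i, k) * B $$ (k, j))" if "i < n" "j < n" for i j
    using assms that by (auto simp: scalar_prod_def atLeast0LessThan)
  show "upper_triangular (A * B)"
  proof
    fix i j assume ji: "j < i" "i < dim_row (A * B)"
    have "A $$ (i, k) * B $$ (k, j) = 0" if "k < n" for k
      using assms ji that by (cases "k < i") (auto simp: upper_triangular_def)
    then show "(A * B) $$ (i, j) = 0"
      using ent[of i j] ji assms by auto
  qed
  assume i: "i < n"
  have "(\<Sum>k<n. A $$ (i, k) * B $$ (k, i)) = (\<Sum>k<n. if k = i then A $$ (i, i) * B $$ (i, i) else 0)"
  proof (intro sum.cong refl)
    fix k assume "k \<in> {..<n}"
    then show "A $$ (i, k) * B $$ (k, i) = (if k = i then A $$ (i, i) * B $$ (i, i) else 0)"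
      using assms i by (cases k i rule: linorder_cases) (auto simp: upper_triangular_def)
  qed
  then show "(A * B) $$ (i, i) = A $$ (i, i) * B $$ (i, i)"
    using ent i by simp
qed

lemma conjugated_mult:
  fixes P :: "'a :: semiring_1 mat"
  assumes [simp]: "P \<in> carrier_mat n n" "Q \<in> carrier_mat n n"
      "S \<in> carrier_mat n n" "T \<in> carrier_mat n n"
    and QP: "Q * P = 1\<^sub>m n"
  shows "(P * S * Q) * (P * T * Q) = P * (S * T) * Q"
proof -
  have "(P * S * Q) * (P * T * Q) = (P * S) * (Q * P) * (T * Q)"
    by (simp add: assoc_mult_mat[of _ n n _ n _ n] mult_carrier_mat[of _ n n _ n])
  then show ?thesis
    by (simp add: QP assoc_mult_mat[of _ n n _ n _ n] mult_carrier_mat[of _ n n _ n]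
        left_mult_one_mat[of _ n n])
qed

text \<open>The trace of \<open>N\<^sup>2\<close> is both the sum of the squares of the entries of \<open>N\<close> and the sum of the
  squares of the diagonal of its triangular form.\<close>

lemma symmetric_similar_strictly_upper_triangular:
  fixes N T :: "real mat"
  assumes N: "N \<in> carrier_mat n n" "transpose_mat N = N"
    and sim: "similar_mat_wit N T P Q"
    and T: "upper_triangular T" "\<And>i. i < n \<Longrightarrow> T $$ (i, i) = 0"
  shows "N = 0\<^sub>m n n"
proof -
  note w = similar_mat_witD2[OF N(1) sim]
  have "N * N = P * (T * T) * Q"
    using conjugated_mult[OF w(6,7,5,5,2)] by (simp only: w(3)[symmetric])
  then have "similar_mat_wit (N * N) (T * T) P Q"
    by (intro similar_mat_witI[OF w(1,2)]) (use w in auto)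
  then have "(\<Sum>i<n. (N * N) $$ (i, i)) = (\<Sum>i<n. (T * T) $$ (i, i))"
    using mat_trace_similar N(1) mult_carrier_mat by blast
  also have "\<dots> = 0"
    using upper_triangular_mult(2)[OF w(5) w(5) T(1) T(1)] T(2) by simp
  finally have "(\<Sum>i<n. (N * N) $$ (i, i)) = 0" .
  moreover have "(N * N) $$ (i, i) = (\<Sum>j<n. (N $$ (i, j))\<^sup>2)" if i: "i < n" for i
  proof -
    have "N $$ (j, i) = N $$ (i, j)" if "j < n" for j
      using N i that by (metis carrier_matD index_transpose_mat(1))
    then show ?thesis
      using N i by (auto simp: scalar_prod_def atLeast0LessThan power2_eq_square)
  qed
  ultimately have "(\<Sum>i<n. \<Sum>j<n. (N $$ (i, j))\<^sup>2) = 0" by simp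
  then have "\<forall>i<n. \<forall>j<n. N $$ (i, j) = 0"
    by (subst (asm) sum_nonneg_eq_0_iff) (auto simp: sum_nonneg sum_nonneg_eq_0_iff)
  then show ?thesis
    using N by (intro eq_matI) auto
qed

text \<open>In the triangular form one of the two shifts vanishes at each diagonal position, so the
  product is similar to a strictly upper triangular matrix. It is also symmetric, because the shifts
  commute, and such a matrix is zero.\<close>

lemma symmetric_two_eigenvalues:
  fixes A :: "real mat"
  assumes A: "A \<in> carrier_mat n n" "transpose_mat A = A"
    and cp: "char_poly A = (\<Prod>e\<leftarrow>es. [:- e, 1:])" and es: "set es \<subseteq> {a, b}"
  shows "(A - a \<cdot>\<^sub>m 1\<^sub>m n) * (A - b \<cdot>\<^sub>m 1\<^sub>m n) = 0\<^sub>m n n"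
    and "(\<Sum>i<n. A $$ (i, i)) = sum_list es"
proof -
  obtain B P Q where "schur_decomposition A es = (B, P, Q)"
    by (metis prod_cases3)
  from schur_decomposition[OF A(1) cp this]
  have sim: "similar_mat_wit A B P Q" and ut: "upper_triangular B" and dg: "diag_mat B = es"
    by auto
  note w = similar_mat_witD2[OF A(1) sim]
  have sumes: "sum_list es = (\<Sum>i<n. B $$ (i, i))"
    unfolding dg[symmetric] diag_mat_def using w(5)
    by (simp add: sum_list_distinct_conv_sum_set atLeast0LessThan)
  then show "(\<Sum>i<n. A $$ (i, i)) = sum_list es"
    using mat_trace_similar[OF A(1) sim] by simp
  have dB: "B $$ (i, i) = a \<or> B $$ (i, i) = b" if "i < n" for i
  proof -
    have "B $$ (i, i) \<in> set (diag_mat B)"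
      using that w(5) by (auto simp: diag_mat_def)
    then show ?thesis using es dg by auto
  qed
  let ?s = "\<lambda>M c. M - c \<cdot>\<^sub>m (1\<^sub>m n :: real mat)"
  have shift: "?s A c = P * ?s B c * Q" for c
  proof -
    have "P * ?s B c * Q = P * B * Q - P * (c \<cdot>\<^sub>m 1\<^sub>m n) * Q"
      using w(5-7)
      by (simp add: minus_mult_distrib_mat[of _ n n _ _ n] mult_minus_distrib_mat[of _ n n _ n])
    also have "P * (c \<cdot>\<^sub>m 1\<^sub>m n) * Q = c \<cdot>\<^sub>m 1\<^sub>m n"
      using w(1,6,7) by (simp add: mult_smult_distrib[of _ n n _ n] mult_smult_assoc_mat[of _ n n _ n])
    also have "P * B * Q = A"
      using w(3) by (rule sym)
    finally show ?thesis by (rule sym)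
  qed
  let ?N = "?s A a * ?s A b" and ?T = "?s B a * ?s B b"
  have [simp]: "?s B c \<in> carrier_mat n n" "?s A c \<in> carrier_mat n n" for c
    using w A by auto
  have "?N = (P * ?s B a * Q) * (P * ?s B b * Q)"
    by (simp only: shift)
  also have "\<dots> = P * ?T * Q"
    by (rule conjugated_mult[OF w(6,7) _ _ w(2)]) simp_all
  finally have simN: "similar_mat_wit ?N ?T P Q"
    by (intro similar_mat_witI[OF w(1,2)]) (use w in \<open>auto intro!: mult_carrier_mat[of _ n n]\<close>)
  have utB: "upper_triangular (?s B c)" for c
    using ut w(5) by (auto simp: upper_triangular_def)
  have "transpose_mat ?N = ?s A b * ?s A a"
  proof -
    have "transpose_mat (?s A c) = ?s A c" for c
    proof -
      have "A $$ (j, i) = A $$ (i, j)" if "i < n" "j < n" for i j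
        using A that by (metis carrier_matD index_transpose_mat(1))
      then show ?thesis using A(1) by (intro eq_matI) auto
    qed
    then show ?thesis
      by (simp add: transpose_mult[of _ n n _ n])
  qed
  also have "\<dots> = ?N"
  proof -
    \<comment> \<open>Symmetric in \<open>c\<close> and \<open>d\<close>, so the two shifts
      commute.\<close>
    have "?s A c * ?s A d = A * A - (c + d) \<cdot>\<^sub>m A + (c * d) \<cdot>\<^sub>m 1\<^sub>m n" for c d
    proof -
      have "?s A c * ?s A d = A * ?s A d - (c \<cdot>\<^sub>m 1\<^sub>m n) * ?s A d"
        using A by (simp add: minus_mult_distrib_mat[of _ n n _ _ n])
      also have "A * ?s A d = A * A - d \<cdot>\<^sub>m A"
        using A by (simp add: mult_minus_distrib_mat[of _ n n _ n] mult_smult_distrib[of _ n n _ n])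
      also have "(c \<cdot>\<^sub>m 1\<^sub>m n) * ?s A d = c \<cdot>\<^sub>m ?s A d"
        using A by (simp add: mult_smult_assoc_mat[of _ n n _ n])
      finally show ?thesis
        using A by (intro eq_matI) (auto simp: algebra_simps)
    qed
    then show ?thesis by (simp add: add.commute mult.commute)
  qed
  finally have symN: "transpose_mat ?N = ?N" .
  show "?N = 0\<^sub>m n n"
  proof (rule symmetric_similar_strictly_upper_triangular[OF _ symN simN])
    show "upper_triangular ?T"
      by (rule upper_triangular_mult[of _ n]) (use utB in auto)
    fix i assume i: "i < n"
    have "?T $$ (i, i) = ?s B a $$ (i, i) * ?s B b $$ (i, i)"
      by (rule upper_triangular_mult[of _ n]) (use utB i in auto)
    also have "\<dots> = 0"
      using dB[OF i] i w(5) by auto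
    finally show "?T $$ (i, i) = 0" .
  qed (use A in auto)
qed

section \<open>Orthogonal projections as Gram matrices\<close>

text \<open>The trace of a symmetric idempotent is its rank, and induction on it peels off one rank
  at a time: a normalised nonzero column \<open>f\<close> is a unit vector fixed by
  \<open>P\<close>, and \<open>P - f f^T\<close> is again a symmetric idempotent, with trace smaller
  by one.\<close>

lemma symmetric_idempotent_decomposition:
  fixes P :: "'a \<Rightarrow> 'a \<Rightarrow> real"
  assumes "finite V"
    and "\<And>u v. u \<in> V \<Longrightarrow> v \<in> V \<Longrightarrow> P u v = P v u"
    and "\<And>u v. u \<in> V \<Longrightarrow> v \<in> V \<Longrightarrow> (\<Sum>w\<in>V. P u w * P w v) = P u v"
    and "(\<Sum>v\<in>V. P v v) = real i"
  shows "\<exists>F :: nat \<Rightarrow> 'a \<Rightarrow> real.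
    (\<forall>k<i. \<forall>l<i. (\<Sum>v\<in>V. F k v * F l v) = (if k = l then 1 else 0)) \<and>
    (\<forall>u\<in>V. \<forall>v\<in>V. P u v = (\<Sum>k<i. F k u * F k v))"
  using assms(2-)
proof (induction i arbitrary: P)
  case 0
  \<comment> \<open>The trace of \<open>P\<close> equals that of \<open>P P^T\<close>, the sum of
    all squared entries, so trace 0 leaves only the zero matrix.\<close>
  have "(\<Sum>v\<in>V. \<Sum>w\<in>V. (P v w)\<^sup>2) = (\<Sum>v\<in>V. P v v)"
  proof (rule sum.cong[OF refl])
    fix v assume v: "v \<in> V"
    have "(\<Sum>w\<in>V. (P v w)\<^sup>2) = (\<Sum>w\<in>V. P v w * P w v)"
      using 0(1)[OF v] by (intro sum.cong) (auto simp: power2_eq_square)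
    then show "(\<Sum>w\<in>V. (P v w)\<^sup>2) = P v v"
      using 0(2) v by simp
  qed
  then have "\<forall>u\<in>V. \<forall>v\<in>V. P u v = 0"
    using 0(3) \<open>finite V\<close>
    by (auto simp: sum_nonneg_eq_0_iff sum_nonneg)
  then show ?case by simp
next
  case (Suc i)
  have "\<exists>j\<in>V. P j j \<noteq> 0"
  proof (rule ccontr)
    assume "\<not> ?thesis"
    then have "(\<Sum>v\<in>V. P v v) = 0" by (simp add: sum.neutral)
    then show False using Suc.prems(3) by simp
  qed
  then obtain j where j: "j \<in> V" "P j j \<noteq> 0" by blast
  \<comment> \<open>Idempotence makes \<open>P j j\<close> the squared norm of row \<open>j\<close>;
    being nonzero it is positive, and its root normalises the column.\<close>
  have "(\<Sum>w\<in>V. (P j w)\<^sup>2) = (\<Sum>w\<in>V. P j w * P w j)"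
    using Suc.prems(1)[OF j(1)] by (intro sum.cong) (auto simp: power2_eq_square)
  also have "\<dots> = P j j"
    using Suc.prems(2) j(1) by blast
  finally have "P j j \<ge> 0"
    using sum_nonneg[of V "\<lambda>w. (P j w)\<^sup>2"] by simp
  then have pos: "P j j > 0" using j(2) by simp
  define f where "f u = P u j / sqrt (P j j)" for u
  have ff: "f u * f v = P u j * P v j / P j j" for u v
  proof -
    have "sqrt (P j j) * sqrt (P j j) = P j j" using pos by simp
    then show ?thesis by (simp only: f_def times_divide_times_eq)
  qed
  define P' where "P' u v = P u v - f u * f v" for u v
  have Pf: "(\<Sum>w\<in>V. P u w * f w) = f u" if "u \<in> V" for u
    using Suc.prems(2)[OF that j(1)] by (simp add: f_def sum_divide_distrib[symmetric])
  have fnorm: "(\<Sum>w\<in>V. f w * f w) = 1"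
  proof -
    have "(\<Sum>w\<in>V. f w * f w) = (\<Sum>w\<in>V. P j w * P w j) / P j j"
      unfolding ff sum_divide_distrib using Suc.prems(1) j by (intro sum.cong) auto
    then show ?thesis using Suc.prems(2) j by simp
  qed
  have P'f: "(\<Sum>w\<in>V. P' u w * f w) = 0" if "u \<in> V" for u
    using Pf[OF that] fnorm
    by (simp add: P'_def left_diff_distrib sum_subtractf mult.assoc sum_distrib_left[symmetric])
  have "\<exists>F. (\<forall>k<i. \<forall>l<i. (\<Sum>v\<in>V. F k v * F l v) = (if k = l then 1 else 0)) \<and>
    (\<forall>u\<in>V. \<forall>v\<in>V. P' u v = (\<Sum>k<i. F k u * F k v))"
  proof (rule Suc.IH)
    fix u v assume uv: "u \<in> V" "v \<in> V"
    show sym: "P' u v = P' v u"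
      using Suc.prems(1) uv by (simp add: P'_def mult.commute)
    \<comment> \<open>As \<open>P'\<close> kills \<open>f\<close>, \<open>P' P' = P' P\<close>, and
      \<open>P' P = P - f f^T\<close> because \<open>P\<close> fixes \<open>f\<close>.\<close>
    have "(\<Sum>w\<in>V. P' u w * P' w v) = (\<Sum>w\<in>V. P' u w * P w v) - (\<Sum>w\<in>V. P' u w * f w) * f v"
      by (simp add: P'_def[of _ v] right_diff_distrib sum_subtractf sum_distrib_right mult.assoc)
    also have "\<dots> = (\<Sum>w\<in>V. P u w * P w v) - (\<Sum>w\<in>V. f u * f w * P w v)"
      unfolding P'f[OF uv(1)] by (simp add: P'_def[of u] left_diff_distrib sum_subtractf)
    also have "(\<Sum>w\<in>V. f u * f w * P w v) = f u * (\<Sum>w\<in>V. P v w * f w)"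
      unfolding sum_distrib_left using Suc.prems(1) uv by (intro sum.cong) auto
    finally show "(\<Sum>w\<in>V. P' u w * P' w v) = P' u v"
      using Suc.prems(2) uv Pf by (simp add: P'_def)
  next
    show "(\<Sum>v\<in>V. P' v v) = real i"
      using Suc.prems(3) fnorm by (simp add: P'_def sum_subtractf)
  qed
  then obtain F where F: "\<And>k l. k < i \<Longrightarrow> l < i \<Longrightarrow> (\<Sum>v\<in>V. F k v * F l v) = (if k = l then 1 else 0)"
    and P'F: "\<And>u v. u \<in> V \<Longrightarrow> v \<in> V \<Longrightarrow> P' u v = (\<Sum>k<i. F k u * F k v)"
    by blast
  \<comment> \<open>Since the \<open>F k\<close> are orthonormal, \<open>P'\<close> fixes
    \<open>F l\<close>; so the inner product of \<open>F l\<close> with \<open>f\<close> equals that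
    with \<open>P' f\<close>, which is 0.\<close>
  have Ff: "(\<Sum>v\<in>V. F l v * f v) = 0" if l: "l < i" for l
  proof -
    have "0 = (\<Sum>u\<in>V. F l u * (\<Sum>v\<in>V. P' u v * f v))"
      using P'f by simp
    also have "\<dots> = (\<Sum>u\<in>V. \<Sum>v\<in>V. \<Sum>k<i. F l u * F k u * (F k v * f v))"
      using P'F by (auto simp: sum_distrib_left sum_distrib_right mult.assoc intro!: sum.cong)
    also have "\<dots> = (\<Sum>v\<in>V. \<Sum>k<i. \<Sum>u\<in>V. F l u * F k u * (F k v * f v))"
      by (subst sum.swap) (intro sum.cong refl sum.swap)
    also have "\<dots> = (\<Sum>v\<in>V. \<Sum>k<i. (if l = k then 1 else 0) * (F k v * f v))"
      using F l by (intro sum.cong refl) (simp add: sum_distrib_right[symmetric])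
    also have "\<dots> = (\<Sum>v\<in>V. \<Sum>k<i. if l = k then F k v * f v else 0)"
      by (intro sum.cong refl) auto
    also have "\<dots> = (\<Sum>v\<in>V. F l v * f v)"
      using l by (simp add: sum.delta)
    finally show ?thesis by simp
  qed
  let ?F = "F(i := f)"
  have "(\<Sum>v\<in>V. ?F k v * ?F l v) = (if k = l then 1 else 0)" if "k < Suc i" "l < Suc i" for k l
  proof -
    have "(\<Sum>v\<in>V. f v * F m v) = 0" if "m < i" for m
      using Ff[OF that] by (simp only: mult.commute)
    moreover have "k < i \<or> k = i" "l < i \<or> l = i"
      using that by auto
    ultimately show ?thesis
      using F Ff fnorm by (elim disjE) simp_all
  qed
  moreover have "P u v = (\<Sum>k<Suc i. ?F k u * ?F k v)" if "u \<in> V" "v \<in> V" for u v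
    using P'F[OF that] by (simp add: P'_def)
  ultimately show ?case by (intro exI[of _ ?F]) blast
qed

section \<open>Characteristic polynomials of Gram matrices\<close>

lemma char_poly_block_lower_triangular:
  fixes A :: "'a :: idom mat"
  assumes "A \<in> carrier_mat n n" "C \<in> carrier_mat m n" "D \<in> carrier_mat m m"
  shows "char_poly (four_block_mat A (0\<^sub>m n m) C D) = char_poly A * char_poly D"
proof -
  have "char_poly_matrix (four_block_mat A (0\<^sub>m n m) C D) =
    four_block_mat (char_poly_matrix A) (0\<^sub>m n m) (map_mat (\<lambda>a. [:- a:]) C) (char_poly_matrix D)"
    using assms by (intro eq_matI) (auto simp: char_poly_matrix_def)
  then show ?thesis
    unfolding char_poly_def
    using det_four_block_mat_upper_right_zero[of "char_poly_matrix A" n _ m] assms by simp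
qed

lemma char_poly_smult_one:
  "char_poly (c \<cdot>\<^sub>m 1\<^sub>m n :: 'a :: idom mat) = [:- c, 1:] ^ n"
proof -
  have "char_poly (c \<cdot>\<^sub>m 1\<^sub>m n :: 'a mat) = (\<Prod>a\<leftarrow>diag_mat (c \<cdot>\<^sub>m 1\<^sub>m n :: 'a mat). [:- a, 1:])"
    by (rule char_poly_upper_triangular[of _ n]) (auto simp: upper_triangular_def)
  also have "diag_mat (c \<cdot>\<^sub>m 1\<^sub>m n :: 'a mat) = replicate n c"
    by (intro nth_equalityI) (auto simp: diag_mat_def)
  finally show ?thesis by (simp add: prod_list_replicate)
qed

text \<open>Sylvester's identity: the block matrices \<open>[AB, 0; B, 0]\<close> and
  \<open>[0, 0; B, BA]\<close> are conjugate by \<open>[1, A; 0, 1]\<close>. For a frame it carries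
  the spectrum of the small scalar matrix \<open>transpose_mat U * U\<close> over to the large Gram
  matrix.\<close>

lemma char_poly_mult_comm:
  fixes A B :: "'a :: idom mat"
  assumes A: "A \<in> carrier_mat n m" and B: "B \<in> carrier_mat m n"
  shows "[:0, 1:] ^ m * char_poly (A * B) = [:0, 1:] ^ n * char_poly (B * A)"
proof -
  let ?L = "four_block_mat (A * B) (0\<^sub>m n m) B (0\<^sub>m m m)"
  let ?R = "four_block_mat (0\<^sub>m n n) (0\<^sub>m n m) B (B * A)"
  let ?P = "four_block_mat (1\<^sub>m n) A (0\<^sub>m m n) (1\<^sub>m m)"
  let ?Q = "four_block_mat (1\<^sub>m n) (- A) (0\<^sub>m m n) (1\<^sub>m m)"
  have one: "four_block_mat (1\<^sub>m n) (0\<^sub>m n m) (0\<^sub>m m n) (1\<^sub>m m) = (1\<^sub>m (n + m) :: 'a mat)"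
    by (intro eq_matI) auto
  have AA: "A + - A = 0\<^sub>m n m" "- A + A = 0\<^sub>m n m"
    using A by (auto intro!: eq_matI)
  have zero: "- 0\<^sub>m m m + 1\<^sub>m m = (1\<^sub>m m :: 'a mat)"
    by (intro eq_matI) auto
  have PQ: "?P * ?Q = 1\<^sub>m (n + m)" "?Q * ?P = 1\<^sub>m (n + m)"
    using A by (subst mult_four_block_mat[of _ n n _ m _ m _ _ n _ m]; simp add: one AA zero)+
  have "?P * ?R = four_block_mat (A * B) (A * (B * A)) B (B * A)"
    using A B by (subst mult_four_block_mat[of _ n n _ m _ m _ _ n _ m]; simp)
  then have "?P * ?R * ?Q =
      four_block_mat (A * B) (A * (B * A)) B (B * A) * four_block_mat (1\<^sub>m n) (- A) (0\<^sub>m m n) (1\<^sub>m m)"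
    by simp
  also have "\<dots> = four_block_mat (A * B) (A * B * - A + A * (B * A)) B (B * - A + B * A)"
    using A B by (subst mult_four_block_mat[of _ n n _ m _ m _ _ n _ m]; simp)
  also have "B * - A + B * A = 0\<^sub>m m m"
  proof -
    have "B * - A = - (B * A)"
      using A B by (intro uminus_mult_right_mat) auto
    then show ?thesis
      using A B by (simp only: uminus_l_inv_mat mult_carrier_mat[OF B A])
  qed
  also have "A * B * - A + A * (B * A) = 0\<^sub>m n m"
  proof -
    have "A * B * - A = - (A * B * A)"
      using A B by (intro uminus_mult_right_mat) auto
    moreover have "A * (B * A) = A * B * A"
      using assoc_mult_mat[OF A B A] by (rule sym)
    moreover have "A * B * A \<in> carrier_mat n m"
      using A B by auto
    ultimately show ?thesis
      by (simp only: uminus_l_inv_mat)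
  qed
  finally have "?L = ?P * ?R * ?Q" by simp
  then have "similar_mat_wit ?L ?R ?P ?Q"
    by (intro similar_mat_witI[OF PQ]) (use A B in auto)
  then have "char_poly ?L = char_poly ?R"
    by (intro char_poly_similar) (auto simp: similar_mat_def)
  moreover have "char_poly ?L = char_poly (A * B) * char_poly (0\<^sub>m m m)"
    by (rule char_poly_block_lower_triangular) (use A B in auto)
  moreover have "char_poly ?R = char_poly (0\<^sub>m n n) * char_poly (B * A)"
    by (rule char_poly_block_lower_triangular) (use A B in auto)
  moreover have "char_poly (0\<^sub>m k k :: 'a mat) = [:0, 1:] ^ k" for k
  proof -
    have "(0\<^sub>m k k :: 'a mat) = 0 \<cdot>\<^sub>m 1\<^sub>m k"
      by (intro eq_matI) auto
    then show ?thesis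
      using char_poly_smult_one[of "0 :: 'a" k] by simp
  qed
  ultimately show ?thesis by (simp add: mult.commute)
qed

section \<open>Multiplicity bipartitions as tight frames\<close>

lemma order_linear_power_other:
  "(a :: 'a :: idom) \<noteq> b \<Longrightarrow> Polynomial.order a ([:- b, 1:] ^ k) = 0"
  by (rule order_0I) auto

lemma monic_poly_two_roots:
  fixes p :: "'a :: field poly"
  assumes "monic p" "a \<noteq> b" "Polynomial.order a p + Polynomial.order b p = degree p"
  shows "p = [:- a, 1:] ^ Polynomial.order a p * [:- b, 1:] ^ Polynomial.order b p"
proof -
  have p0: "p \<noteq> 0" using assms(1) by auto
  obtain q where q: "p = [:- a, 1:] ^ Polynomial.order a p * q"
    using order_1 by blast
  have "Polynomial.order b p = Polynomial.order b q"
    using order_mult[of "[:- a, 1:] ^ Polynomial.order a p" q b] p0 q assms(2)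
    by (simp add: order_linear_power_other)
  then obtain r where r: "q = [:- b, 1:] ^ Polynomial.order b p * r"
    using order_1[of b q] by auto
  let ?m = "[:- a, 1:] ^ Polynomial.order a p * [:- b, 1:] ^ Polynomial.order b p"
  have pr: "p = ?m * r"
    using q r by (simp add: mult.assoc)
  have m: "monic ?m"
    by (intro monic_mult monic_power) auto
  have "degree ?m = degree p"
    using assms(3) by (simp add: degree_mult_eq degree_power_eq)
  moreover have "degree p = degree ?m + degree r"
    using p0 pr by (metis degree_mult_eq mult_eq_0_iff)
  ultimately have "degree r = 0" by simp
  moreover have "lead_coeff r = 1"
    using assms(1) m pr by (metis lead_coeff_mult mult_1)
  ultimately have "r = 1"
    by (metis degree_0_id lead_coeff_pCons(2) one_pCons)
  then show ?thesis using pr by simp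
qed

text \<open>The columns of \<open>F\<close> are vectors in \<open>\<real>\<^sup>i\<close>, one for each vertex.\<close>

definition frame_representation ::
  "'a pair_pre_digraph \<Rightarrow> nat \<Rightarrow> (nat \<Rightarrow> 'a \<Rightarrow> real) \<Rightarrow> real \<Rightarrow> bool" where
  "frame_representation X i F c \<longleftrightarrow> c > 0 \<and>
     (\<forall>k<i. \<forall>l<i. (\<Sum>v\<in>pverts X. F k v * F l v) = (if k = l then c else 0)) \<and>
     (\<forall>u\<in>pverts X. \<forall>v\<in>pverts X. u \<noteq> v \<longrightarrow>
        ((u, v) \<in> parcs X \<longleftrightarrow> (\<Sum>k<i. F k u * F k v) \<noteq> 0))"

text \<open>The matrix \<open>P = (A - a) / (b - a)\<close> is the projection onto the eigenspace of
  \<open>b\<close>. Its trace is the multiplicity of \<open>b\<close>, and off the diagonal it has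
  the zero pattern of \<open>A\<close>, so its orthonormal decomposition is the frame.\<close>

lemma multiplicity_bipartition_imp_frame:
  assumes V: "pverts X = {0..<n}" and mb: "multiplicity_bipartition X p i"
  shows "\<exists>F. frame_representation X i F 1"
proof -
  from mb[unfolded multiplicity_bipartition_def] V
  obtain A a b where i: "1 \<le> i" "i \<le> n - 1" "p = n - i" and A: "A \<in> graph_matrices X"
    and ab: "a \<noteq> b" and ord: "Polynomial.order a (char_poly A) = p" "Polynomial.order b (char_poly A) = i"
    by auto
  have A1: "A \<in> carrier_mat n n" and A2: "transpose_mat A = A"
    and A3: "\<And>u v. u < n \<Longrightarrow> v < n \<Longrightarrow> u \<noteq> v \<Longrightarrow> A $$ (u, v) \<noteq> 0 \<longleftrightarrow> (u, v) \<in> parcs X"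
    using A V by (auto simp: graph_matrices_def Let_def)
  \<comment> \<open>The two orders add up to \<open>n\<close>, so the characteristic polynomial
    splits over the reals; the triangular form is built from this list of roots.\<close>
  define es where "es = replicate p a @ replicate i b"
  have deg: "degree (char_poly A) = n" and mon: "monic (char_poly A)"
    using degree_monic_char_poly[OF A1] by auto
  have "char_poly A = [:- a, 1:] ^ p * [:- b, 1:] ^ i"
    using monic_poly_two_roots[OF mon ab] ord i deg by simp
  then have cp: "char_poly A = (\<Prod>e\<leftarrow>es. [:- e, 1:])"
    by (simp add: es_def prod_list_replicate)
  have "set es \<subseteq> {a, b}" by (auto simp: es_def)
  note sp = symmetric_two_eigenvalues[OF A1 A2 cp this]
  have tr: "(\<Sum>u<n. A $$ (u, u)) = real p * a + real i * b"
    using sp(2) by (simp add: es_def sum_list_replicate)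
  define P where "P u v = (A $$ (u, v) - (if u = v then a else 0)) / (b - a)" for u v
  have "\<exists>F :: nat \<Rightarrow> nat \<Rightarrow> real.
    (\<forall>k<i. \<forall>l<i. (\<Sum>v\<in>{0..<n}. F k v * F l v) = (if k = l then 1 else 0)) \<and>
    (\<forall>u\<in>{0..<n}. \<forall>v\<in>{0..<n}. P u v = (\<Sum>k<i. F k u * F k v))"
  proof (rule symmetric_idempotent_decomposition)
    fix u v assume uv: "u \<in> {0..<n}" "v \<in> {0..<n}"
    show "P u v = P v u"
    proof -
      have "A $$ (u, v) = transpose_mat A $$ (u, v)" by (simp only: A2)
      also have "\<dots> = A $$ (v, u)" using uv A1 by simp
      finally show ?thesis by (simp add: P_def)
    qed
    have "0 = ((A - a \<cdot>\<^sub>m 1\<^sub>m n) * (A - b \<cdot>\<^sub>m 1\<^sub>m n)) $$ (u, v)"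
      using sp(1) uv by simp
    also have "\<dots> = (\<Sum>w\<in>{0..<n}. (A - a \<cdot>\<^sub>m 1\<^sub>m n) $$ (u, w) * (A - b \<cdot>\<^sub>m 1\<^sub>m n) $$ (w, v))"
      using uv A1 by (simp add: scalar_prod_def)
    \<comment> \<open>In terms of \<open>P\<close> the factors are \<open>(b - a) P\<close> and
      \<open>(b - a) (P - 1)\<close>, so their vanishing product is idempotence.\<close>
    also have "\<dots> = (\<Sum>w\<in>{0..<n}. (b - a)\<^sup>2 * (P u w * P w v) - (if w = v then (b - a)\<^sup>2 * P u v else 0))"
    proof (intro sum.cong refl)
      fix w assume w: "w \<in> {0..<n}"
      have "(A - a \<cdot>\<^sub>m 1\<^sub>m n) $$ (u, w) = (b - a) * P u w"
        using uv w A1 ab by (simp add: P_def)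
      moreover have "(A - b \<cdot>\<^sub>m 1\<^sub>m n) $$ (w, v) = (b - a) * P w v - (if w = v then b - a else 0)"
        using uv w A1 ab by (simp add: P_def)
      ultimately show "(A - a \<cdot>\<^sub>m 1\<^sub>m n) $$ (u, w) * (A - b \<cdot>\<^sub>m 1\<^sub>m n) $$ (w, v) =
          (b - a)\<^sup>2 * (P u w * P w v) - (if w = v then (b - a)\<^sup>2 * P u v else 0)"
        by (simp only:) (simp add: power2_eq_square algebra_simps)
    qed
    also have "\<dots> = (b - a)\<^sup>2 * ((\<Sum>w\<in>{0..<n}. P u w * P w v) - P u v)"
      using uv by (simp add: sum_subtractf sum_distrib_left[symmetric] right_diff_distrib sum.delta')
    finally show "(\<Sum>w\<in>{0..<n}. P u w * P w v) = P u v"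
      using ab by auto
  next
    have "(\<Sum>v\<in>{0..<n}. P v v) = ((\<Sum>v<n. A $$ (v, v)) - real n * a) / (b - a)"
      by (simp add: P_def sum_divide_distrib[symmetric] sum_subtractf atLeast0LessThan)
    also have "\<dots> = real i"
    proof -
      have "real n = real p + real i" using i by simp
      then show ?thesis using tr ab by (simp add: field_simps)
    qed
    finally show "(\<Sum>v\<in>{0..<n}. P v v) = real i" .
  qed simp
  then obtain F where F: "\<forall>k<i. \<forall>l<i. (\<Sum>v\<in>{0..<n}. F k v * F l v) = (if k = l then 1 else 0)"
    "\<forall>u\<in>{0..<n}. \<forall>v\<in>{0..<n}. P u v = (\<Sum>k<i. F k u * F k v)" by blast
  have "(u, v) \<in> parcs X \<longleftrightarrow> (\<Sum>k<i. F k u * F k v) \<noteq> 0" if "u < n" "v < n" "u \<noteq> v" for u v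
  proof -
    have "(\<Sum>k<i. F k u * F k v) = A $$ (u, v) / (b - a)"
      using F(2)[rule_format, of u v] that by (simp add: P_def)
    then show ?thesis using A3[OF that] ab by simp
  qed
  then have "frame_representation X i F 1"
    using F(1) V by (simp add: frame_representation_def)
  then show ?thesis by blast
qed

text \<open>The Gram matrix \<open>U * transpose_mat U\<close> does it: tightness says that
  \<open>transpose_mat U * U\<close> is \<open>c\<close> times the identity, so the eigenvalues are
  \<open>c\<close>, of multiplicity \<open>i\<close>, and 0 for the rest. Leaving \<open>c\<close>
  free spares the constructions a normalisation.\<close>

lemma frame_imp_multiplicity_bipartition:
  assumes V: "pverts X = {0..<n}" and i: "1 \<le> i" "i \<le> n - 1" and F: "frame_representation X i F c"
  shows "multiplicity_bipartition X (n - i) i"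
proof -
  have c: "c > 0" and orth: "\<And>k l. k < i \<Longrightarrow> l < i \<Longrightarrow> (\<Sum>v\<in>{0..<n}. F k v * F l v) = (if k = l then c else 0)"
    and arcs: "\<And>u v. u < n \<Longrightarrow> v < n \<Longrightarrow> u \<noteq> v \<Longrightarrow> (u, v) \<in> parcs X \<longleftrightarrow> (\<Sum>k<i. F k u * F k v) \<noteq> 0"
    using F V by (auto simp: frame_representation_def)
  define U where "U = mat n i (\<lambda>(v, k). F k v)"
  let ?Ut = "transpose_mat U"
  have U: "U \<in> carrier_mat n i" and Ut: "?Ut \<in> carrier_mat i n"
    by (auto simp: U_def)
  define A where "A = U * ?Ut"
  have A: "A \<in> carrier_mat n n" using U by (simp add: A_def)
  have Aent: "A $$ (u, v) = (\<Sum>k<i. F k u * F k v)" if "u < n" "v < n" for u v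
    using that by (simp add: A_def U_def scalar_prod_def atLeast0LessThan)
  have sym: "transpose_mat A = A"
    using A by (intro eq_matI) (auto simp: Aent mult.commute)
  have "?Ut * U = c \<cdot>\<^sub>m 1\<^sub>m i"
    using orth by (intro eq_matI) (auto simp: U_def scalar_prod_def)
  then have "[:0, 1:] ^ i * char_poly A = [:0, 1:] ^ n * [:- c, 1:] ^ i"
    using char_poly_mult_comm[OF U Ut] char_poly_smult_one[of c i] by (simp add: A_def)
  also have "([:0, 1:] :: real poly) ^ n = [:0, 1:] ^ i * [:0, 1:] ^ (n - i)"
    using i by (simp add: power_add[symmetric])
  finally have cp: "char_poly A = [:0, 1:] ^ (n - i) * [:- c, 1:] ^ i"
    by (simp add: mult.assoc)
  have nz: "[:0, 1:] ^ (n - i) * [:- c, 1:] ^ i \<noteq> 0" by simp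
  have "Polynomial.order 0 (char_poly A) = n - i"
    unfolding cp order_mult[OF nz] using order_power_n_n[of 0 "n - i"] c
    by (simp add: order_linear_power_other)
  moreover have "Polynomial.order c (char_poly A) = i"
    unfolding cp order_mult[OF nz] using order_linear_power_other[of c 0 "n - i"] c
    by (simp add: order_power_n_n)
  \<comment> \<open>Both bounds on \<open>i\<close> enter here: each exponent must be positive for
    its root to be an eigenvalue.\<close>
  moreover have "{l. eigenvalue A l} = {0, c}"
    unfolding eigenvalue_root_char_poly[OF A] cp using i by auto
  moreover have AX: "A \<in> graph_matrices X"
    using A sym arcs V by (simp add: graph_matrices_def Let_def Aent)
  ultimately have "\<exists>l1 l2. l1 \<noteq> l2 \<and> {l. eigenvalue A l} = {l1, l2} \<and>
      Polynomial.order l1 (char_poly A) = n - i \<and> Polynomial.order l2 (char_poly A) = i"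
    using c by (intro exI[of _ 0] exI[of _ c]) simp
  then show ?thesis
    using i V AX unfolding multiplicity_bipartition_def by auto
qed

section \<open>Isomorphism types as vertex labellings\<close>

text \<open>For \<open>with_proj\<close> digraphs tail and head are the projections, so the action
  of an isomorphism on arcs is forced by its vertex map.\<close>

lemma graph_iso_iff:
  assumes X: "pair_wf_digraph X" and Y: "pair_wf_digraph Y"
  shows "graph_iso X Y \<longleftrightarrow> (\<exists>f. bij_betw f (pverts X) (pverts Y) \<and>
    (\<forall>u\<in>pverts X. \<forall>v\<in>pverts X. (u, v) \<in> parcs X \<longleftrightarrow> (f u, f v) \<in> parcs Y))"
    (is "_ \<longleftrightarrow> ?R")
proof
  assume "graph_iso X Y"
  then obtain h where h: "pre_digraph.digraph_isomorphism (with_proj X) h"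
    and Yh: "with_proj Y = app_iso h (with_proj X)"
    by (auto simp: digraph_iso_def)
  let ?f = "iso_verts h"
  have inj: "inj_on ?f (pverts X)"
    and ta: "\<And>a. a \<in> parcs X \<Longrightarrow> ?f (fst a) = iso_tail h (iso_arcs h a)"
    and he: "\<And>a. a \<in> parcs X \<Longrightarrow> ?f (snd a) = iso_head h (iso_arcs h a)"
    using h by (auto simp: pre_digraph.digraph_isomorphism_def)
  have Y': "pverts Y = ?f ` pverts X" "parcs Y = iso_arcs h ` parcs X" "fst = iso_tail h" "snd = iso_head h"
    using Yh by (simp_all add: with_proj_def app_iso_def)
  have arc: "iso_arcs h (u, v) = (?f u, ?f v)" if "(u, v) \<in> parcs X" for u v
    using ta[OF that] he[OF that] Y'(3,4) by (metis fst_conv snd_conv prod.collapse)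
  have "(u, v) \<in> parcs X \<longleftrightarrow> (?f u, ?f v) \<in> parcs Y" if uv: "u \<in> pverts X" "v \<in> pverts X" for u v
  proof
    assume "(u, v) \<in> parcs X"
    then show "(?f u, ?f v) \<in> parcs Y"
      using arc Y'(2) by (metis imageI)
  next
    assume "(?f u, ?f v) \<in> parcs Y"
    then obtain u' v' where e: "(u', v') \<in> parcs X" "(?f u, ?f v) = iso_arcs h (u', v')"
      using Y'(2) by auto
    then have "?f u = ?f u'" "?f v = ?f v'"
      using arc by auto
    moreover have "u' \<in> pverts X" "v' \<in> pverts X"
      using e(1) X by (auto simp: pair_wf_digraph_def)
    ultimately show "(u, v) \<in> parcs X"
      using e(1) inj uv by (auto dest: inj_onD)
  qed
  then show ?R
    using inj Y'(1) by (intro exI[of _ ?f]) (auto simp: bij_betw_def)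
next
  assume ?R
  then obtain f where f: "bij_betw f (pverts X) (pverts Y)"
    and arc: "\<And>u v. u \<in> pverts X \<Longrightarrow> v \<in> pverts X \<Longrightarrow> (u, v) \<in> parcs X \<longleftrightarrow> (f u, f v) \<in> parcs Y"
    by blast
  interpret X: pair_wf_digraph X by fact
  interpret Y: pair_wf_digraph Y by fact
  show "graph_iso X Y"
  proof (rule graph_isoI[OF X])
    show "inj_on f (pverts X)" "pverts Y = f ` pverts X"
      using f by (auto simp: bij_betw_def)
    show "parcs Y = map_prod f f ` parcs X"
    proof
      show "map_prod f f ` parcs X \<subseteq> parcs Y"
      proof (rule image_subsetI)
        fix e assume e: "e \<in> parcs X"
        obtain u v where "e = (u, v)" by fastforce
        then show "map_prod f f e \<in> parcs Y"
          using arc[of u v] X.in_arcsD1[of u v] X.in_arcsD2[of u v] e by simp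
      qed
      show "parcs Y \<subseteq> map_prod f f ` parcs X"
      proof
        fix e assume e: "e \<in> parcs Y"
        obtain x y where xy: "e = (x, y)" by fastforce
        then have "x \<in> f ` pverts X" "y \<in> f ` pverts X"
          using Y.wellformed' e f by (auto simp: bij_betw_def)
        then obtain u v where "u \<in> pverts X" "v \<in> pverts X" "e = map_prod f f (u, v)"
          using xy by auto
        then show "e \<in> map_prod f f ` parcs X"
          using arc[of u v] e by auto
      qed
    qed
  qed
qed

lemma pverts_graph_union: "pverts (graph_union X Y) = Inl ` pverts X \<union> Inr ` pverts Y"
  by (simp add: graph_union_def)

lemma parcs_graph_union:
  "(Inl u, Inl u') \<in> parcs (graph_union X Y) \<longleftrightarrow> (u, u') \<in> parcs X"
  "(Inr v, Inr v') \<in> parcs (graph_union X Y) \<longleftrightarrow> (v, v') \<in> parcs Y"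
  "(Inl u, Inr v) \<notin> parcs (graph_union X Y)"
  "(Inr v, Inl u) \<notin> parcs (graph_union X Y)"
  by (auto simp: graph_union_def intro: rev_image_eqI)

lemma pverts_graph_join: "pverts (graph_join X Y) = Inl ` pverts X \<union> Inr ` pverts Y"
  by (simp add: graph_join_def)

lemma pverts_complete_graph: "pverts (complete_graph m) = {0..<m}"
  by (simp add: complete_graph_def)

lemma parcs_complete_graph: "(u, v) \<in> parcs (complete_graph m) \<longleftrightarrow> u < m \<and> v < m \<and> u \<noteq> v"
  by (auto simp: complete_graph_def)

lemma pair_wf_digraph_complete_graph: "pair_wf_digraph (complete_graph m)"
  by unfold_locales (auto simp: complete_graph_def)

lemma pair_wf_digraph_graph_union:
  assumes "pair_wf_digraph X" "pair_wf_digraph Y"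
  shows "pair_wf_digraph (graph_union X Y)"
proof -
  interpret X: pair_wf_digraph X by fact
  interpret Y: pair_wf_digraph Y by fact
  show ?thesis
    by unfold_locales (auto simp: graph_union_def dest: X.wellformed' Y.wellformed')
qed

lemma pair_wf_digraph_graph_join:
  assumes "pair_wf_digraph X" "pair_wf_digraph Y"
  shows "pair_wf_digraph (graph_join X Y)"
proof -
  interpret X: pair_wf_digraph X by fact
  interpret Y: pair_wf_digraph Y by fact
  show ?thesis
    by unfold_locales (auto simp: graph_join_def dest: X.wellformed' Y.wellformed')
qed

text \<open>Every complete graph numbers its vertices from 0, so each class is enumerated
  separately, yet by one function on all of \<open>V\<close>.\<close>

lemma finite_classes_enumeration:
  assumes "finite V"
  obtains idx :: "'a \<Rightarrow> nat"
  where "\<And>c. bij_betw idx {v \<in> V. cl v = c} {0..<card {v \<in> V. cl v = c}}"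
proof -
  have "\<exists>h. bij_betw h {v \<in> V. cl v = c} {0..<card {v \<in> V. cl v = c}}" for c
    by (rule ex_bij_betw_finite_nat) (use assms in simp)
  then obtain h where h: "\<And>c. bij_betw (h c) {v \<in> V. cl v = c} {0..<card {v \<in> V. cl v = c}}"
    by metis
  have "bij_betw (\<lambda>v. h (cl v) v) {v \<in> V. cl v = c} {0..<card {v \<in> V. cl v = c}}" for c
    using h[of c] by (subst bij_betw_cong[of _ _ "h c"]) auto
  then show ?thesis by (rule that)
qed

lemma graph_iso_complete_graph_iff:
  assumes "pair_graph X"
  shows "(\<exists>m. graph_iso X (complete_graph m)) \<longleftrightarrow>
    (\<forall>u\<in>pverts X. \<forall>v\<in>pverts X. u \<noteq> v \<longrightarrow> (u, v) \<in> parcs X)"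
proof -
  interpret pair_graph X by fact
  note iso = graph_iso_iff[OF pair_wf_digraph pair_wf_digraph_complete_graph]
  show ?thesis
  proof
    assume "\<exists>m. graph_iso X (complete_graph m)"
    then obtain m :: nat and f where "bij_betw f (pverts X) {0..<m}"
      and "\<forall>u\<in>pverts X. \<forall>v\<in>pverts X. (u, v) \<in> parcs X \<longleftrightarrow> f u < m \<and> f v < m \<and> f u \<noteq> f v"
      unfolding iso pverts_complete_graph parcs_complete_graph by blast
    then show "\<forall>u\<in>pverts X. \<forall>v\<in>pverts X. u \<noteq> v \<longrightarrow> (u, v) \<in> parcs X"
      by (auto simp: bij_betw_def dest: inj_onD)
  next
    assume adj: "\<forall>u\<in>pverts X. \<forall>v\<in>pverts X. u \<noteq> v \<longrightarrow> (u, v) \<in> parcs X"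
    obtain f where f: "bij_betw f (pverts X) {0..<card (pverts X)}"
      using ex_bij_betw_finite_nat pair_finite_verts by blast
    have "(u, v) \<in> parcs X \<longleftrightarrow> (f u, f v) \<in> parcs (complete_graph (card (pverts X)))"
      if "u \<in> pverts X" "v \<in> pverts X" for u v
    proof -
      have "f u < card (pverts X)" "f v < card (pverts X)"
        using f that by (auto simp: bij_betw_def)
      moreover have "f u = f v \<longleftrightarrow> u = v"
        using f that by (auto simp: bij_betw_def dest: inj_onD)
      ultimately show ?thesis
        using adj that no_loops' by (auto simp: parcs_complete_graph)
    qed
    then show "\<exists>m. graph_iso X (complete_graph m)"
      unfolding iso using f by (auto simp: pverts_complete_graph)
  qed
qed

text \<open>In such a join two distinct vertices are nonadjacent exactly if they lie in one block on
  opposite sides, so \<open>g\<close> is the block and \<open>s\<close> the side. Conversely the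
  sizes \<open>a\<close> and \<open>b\<close> are recovered by counting label classes.\<close>

lemma graph_iso_joins_iff:
  assumes "pair_graph X"
  shows "(\<exists>(k::nat) (a :: nat \<Rightarrow> nat) (b :: nat \<Rightarrow> nat). k > 1 \<and>
       graph_iso X
         (graph_joins k (\<lambda>i. graph_union (complete_graph (a i)) (complete_graph (b i))))) \<longleftrightarrow>
    (\<exists>(g :: 'a \<Rightarrow> nat) (s :: 'a \<Rightarrow> bool). \<forall>u\<in>pverts X. \<forall>v\<in>pverts X. u \<noteq> v \<longrightarrow>
       ((u, v) \<in> parcs X \<longleftrightarrow> \<not> (g u = g v \<and> s u \<noteq> s v)))"
    (is "?L \<longleftrightarrow> ?R")
proof -
  interpret pair_graph X by fact
  note iso = graph_iso_iff[OF pair_wf_digraph pair_wf_digraph_graph_joins]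
  let ?F = "\<lambda>a b i. graph_union (complete_graph (a i)) (complete_graph (b i))"
  note simps = parcs_graph_joins pverts_graph_joins parcs_graph_union pverts_graph_union
    pverts_complete_graph parcs_complete_graph
  show ?thesis
  proof
    assume ?L
    then obtain k a b f where f: "bij_betw f (pverts X) (pverts (graph_joins k (?F a b)))"
      and arc: "\<And>u v. u \<in> pverts X \<Longrightarrow> v \<in> pverts X \<Longrightarrow>
        (u, v) \<in> parcs X \<longleftrightarrow> (f u, f v) \<in> parcs (graph_joins k (?F a b))"
      unfolding iso by blast
    have "(u, v) \<in> parcs X \<longleftrightarrow>
        \<not> (fst (f u) = fst (f v) \<and> isl (snd (f u)) \<noteq> isl (snd (f v)))"
      if uv: "u \<in> pverts X" "v \<in> pverts X" "u \<noteq> v" for u v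
    proof -
      obtain i x j y where fu: "f u = (i, x)" and fv: "f v = (j, y)"
        by fastforce
      have "f u \<in> pverts (graph_joins k (?F a b))" "f v \<in> pverts (graph_joins k (?F a b))"
        "f u \<noteq> f v"
        using f uv by (auto simp: bij_betw_def dest: inj_onD)
      then show ?thesis
        unfolding arc[OF uv(1,2)] fu fv
        by (cases x; cases y) (auto simp: simps)
    qed
    then show ?R
      by (intro exI[of _ "\<lambda>v. fst (f v)"] exI[of _ "\<lambda>v. isl (snd (f v))"]) blast
  next
    assume ?R
    then obtain g :: "'a \<Rightarrow> nat" and s :: "'a \<Rightarrow> bool"
      where "\<forall>u\<in>pverts X. \<forall>v\<in>pverts X. u \<noteq> v \<longrightarrow>
        ((u, v) \<in> parcs X \<longleftrightarrow> \<not> (g u = g v \<and> s u \<noteq> s v))"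
      by (elim exE)
    then have arc: "(u, v) \<in> parcs X \<longleftrightarrow> \<not> (g u = g v \<and> s u \<noteq> s v)"
      if "u \<in> pverts X" "v \<in> pverts X" "u \<noteq> v" for u v
      using that by (elim ballE[of _ _ u] ballE[of _ _ v]) simp_all
    let ?C = "\<lambda>c. {v \<in> pverts X. (g v, s v) = c}"
    obtain idx where idx: "\<And>c. bij_betw idx (?C c) {0..<card (?C c)}"
      using finite_classes_enumeration[OF pair_finite_verts, of "\<lambda>v. (g v, s v)"] by blast
    define k where "k = Suc (Suc (Max (insert 0 (g ` pverts X))))"
    have gk: "g v < k" if "v \<in> pverts X" for v
      unfolding k_def using that pair_finite_verts by (simp add: less_Suc_eq_le le_SucI)
    define a where "a i = card (?C (i, True))" for i
    define b where "b i = card (?C (i, False))" for i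
    define f where "f v = (g v, if s v then Inl (idx v) else Inr (idx v))" for v
    have lt: "idx v < (if s v then a (g v) else b (g v))" if "v \<in> pverts X" for v
      using bij_betw_apply[OF idx[of "(g v, s v)"], of v] that by (auto simp: a_def b_def)
    have inj: "inj_on f (pverts X)"
    proof (rule inj_onI)
      fix u v assume uv: "u \<in> pverts X" "v \<in> pverts X" and eq: "f u = f v"
      then have "g u = g v" "s u = s v" "idx u = idx v"
        by (auto simp: f_def split: if_splits)
      then show "u = v"
        using bij_betw_imp_inj_on[OF idx[of "(g v, s v)"]] uv by (auto dest: inj_onD)
    qed
    have surj: "\<exists>v\<in>pverts X. g v = i \<and> s v = t \<and> idx v = x" if "x < card (?C (i, t))" for i t x
    proof -
      have "x \<in> idx ` ?C (i, t)"
        using bij_betw_imp_surj_on[OF idx[of "(i, t)"]] that by simp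
      then show ?thesis by auto
    qed
    have "bij_betw f (pverts X) (pverts (graph_joins k (?F a b)))"
    proof (rule bij_betw_imageI[OF inj], intro equalityI subsetI)
      fix z assume "z \<in> f ` pverts X"
      then show "z \<in> pverts (graph_joins k (?F a b))"
        using gk lt by (fastforce simp: f_def simps split: if_splits)
    next
      fix z assume z: "z \<in> pverts (graph_joins k (?F a b))"
      obtain i x where [simp]: "z = (i, x)" by fastforce
      show "z \<in> f ` pverts X"
      proof (cases x)
        case (Inl y)
        then have "y < card (?C (i, True))" using z by (auto simp: simps a_def)
        then show ?thesis using surj[of y i True] Inl by (force simp: f_def)
      next
        case (Inr y)
        then have "y < card (?C (i, False))" using z by (auto simp: simps b_def)
        then show ?thesis using surj[of y i False] Inr by (force simp: f_def)
      qed
    qed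
    moreover have "(u, v) \<in> parcs X \<longleftrightarrow> (f u, f v) \<in> parcs (graph_joins k (?F a b))"
      if uv: "u \<in> pverts X" "v \<in> pverts X" for u v
    proof (cases "u = v")
      case True
      then show ?thesis
        using no_loops' by (auto simp: f_def simps)
    next
      case False
      then have "f u \<noteq> f v" using inj uv by (auto dest: inj_onD)
      then show ?thesis
        unfolding arc[OF uv False] using uv gk[OF uv(1)] gk[OF uv(2)] lt[OF uv(1)] lt[OF uv(2)]
        by (auto simp: f_def simps)
    qed
    ultimately have "graph_iso X (graph_joins k (?F a b))"
      unfolding iso by blast
    moreover have "k > 1" by (simp add: k_def)
    ultimately show ?L by blast
  qed
qed

text \<open>\<open>d\<close> is the apex, sent to the vertex of \<open>complete_graph 1\<close>;
  \<open>s\<close> records the side of the other vertices.\<close>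

lemma graph_iso_cone_iff:
  assumes "pair_graph X"
  shows "(\<exists>a b. graph_iso X
         (graph_join (graph_union (complete_graph a) (complete_graph b)) (complete_graph 1))) \<longleftrightarrow>
    (\<exists>d\<in>pverts X. \<exists>s :: 'a \<Rightarrow> bool. \<forall>u\<in>pverts X. \<forall>v\<in>pverts X. u \<noteq> v \<longrightarrow>
       ((u, v) \<in> parcs X \<longleftrightarrow> u = d \<or> v = d \<or> s u = s v))"
    (is "?L \<longleftrightarrow> ?R")
proof -
  interpret pair_graph X by fact
  let ?Y = "\<lambda>a b. graph_join (graph_union (complete_graph a) (complete_graph b)) (complete_graph 1)"
  have iso: "graph_iso X (?Y a b) \<longleftrightarrow> (\<exists>f. bij_betw f (pverts X) (pverts (?Y a b)) \<and>
    (\<forall>u\<in>pverts X. \<forall>v\<in>pverts X. (u, v) \<in> parcs X \<longleftrightarrow> (f u, f v) \<in> parcs (?Y a b)))" for a b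
    by (intro graph_iso_iff pair_wf_digraph pair_wf_digraph_graph_join pair_wf_digraph_graph_union
        pair_wf_digraph_complete_graph)
  note simps = parcs_graph_join pverts_graph_join parcs_graph_union pverts_graph_union
    pverts_complete_graph parcs_complete_graph
  show ?thesis
  proof
    assume ?L
    then obtain a b f where f: "bij_betw f (pverts X) (pverts (?Y a b))"
      and arc: "\<And>u v. u \<in> pverts X \<Longrightarrow> v \<in> pverts X \<Longrightarrow>
        (u, v) \<in> parcs X \<longleftrightarrow> (f u, f v) \<in> parcs (?Y a b)"
      unfolding iso by blast
    have "Inr 0 \<in> f ` pverts X"
      using bij_betw_imp_surj_on[OF f] by (auto simp: simps)
    then obtain d where d: "d \<in> pverts X" "f d = Inr 0" by auto
    \<comment> \<open>\<open>projl (f d)\<close> is an unspecified value, harmless because the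
      disjuncts \<open>u = d\<close> and \<open>v = d\<close> settle that case.\<close>
    have "(u, v) \<in> parcs X \<longleftrightarrow> u = d \<or> v = d \<or> isl (projl (f u)) = isl (projl (f v))"
      if uv: "u \<in> pverts X" "v \<in> pverts X" "u \<noteq> v" for u v
    proof -
      have fv: "f u \<in> pverts (?Y a b)" "f v \<in> pverts (?Y a b)"
        using f uv by (auto simp: bij_betw_def)
      have eq: "f x = f y \<longleftrightarrow> x = y" if "x \<in> pverts X" "y \<in> pverts X" for x y
        using f that by (auto simp: bij_betw_def dest: inj_onD)
      have "f u \<noteq> f v" "u = d \<longleftrightarrow> f u = Inr 0" "v = d \<longleftrightarrow> f v = Inr 0"
        using eq[of u v] eq[of u d] eq[of v d] d uv by auto
      then show ?thesis
        unfolding arc[OF uv(1,2)] using fv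
        by (cases "f u"; cases "f v"; cases "projl (f u)"; cases "projl (f v)") (auto simp: simps)
    qed
    then show ?R
      using d(1) by (intro bexI[of _ d] exI[of _ "\<lambda>v. isl (projl (f v))"]) blast
  next
    assume ?R
    then obtain d and s :: "'a \<Rightarrow> bool" where d: "d \<in> pverts X"
      and "\<forall>u\<in>pverts X. \<forall>v\<in>pverts X. u \<noteq> v \<longrightarrow> ((u, v) \<in> parcs X \<longleftrightarrow> u = d \<or> v = d \<or> s u = s v)"
      by (elim bexE exE)
    then have arc: "(u, v) \<in> parcs X \<longleftrightarrow> u = d \<or> v = d \<or> s u = s v"
      if "u \<in> pverts X" "v \<in> pverts X" "u \<noteq> v" for u v
      using that by (elim ballE[of _ _ u] ballE[of _ _ v]) simp_all
    let ?C = "\<lambda>c. {v \<in> pverts X - {d}. s v = c}"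
    obtain idx where idx: "\<And>c. bij_betw idx (?C c) {0..<card (?C c)}"
      using finite_classes_enumeration[of "pverts X - {d}" s] pair_finite_verts by blast
    define a where "a = card (?C True)"
    define b where "b = card (?C False)"
    define f where "f v = (if v = d then Inr (0 :: nat) else Inl (if s v then Inl (idx v) else Inr (idx v)))" for v
    have lt: "idx v < (if s v then a else b)" if "v \<in> pverts X" "v \<noteq> d" for v
      using bij_betw_apply[OF idx[of "s v"], of v] that by (auto simp: a_def b_def)
    have inj: "inj_on f (pverts X)"
    proof (rule inj_onI)
      fix u v assume uv: "u \<in> pverts X" "v \<in> pverts X" and eq: "f u = f v"
      show "u = v"
      proof (cases "u = d \<or> v = d")
        case True
        then show ?thesis using eq by (auto simp: f_def split: if_splits)
      next
        case False
        then have "s u = s v" "idx u = idx v"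
          using eq by (auto simp: f_def split: if_splits)
        then show "u = v"
          using bij_betw_imp_inj_on[OF idx[of "s v"]] uv False by (auto dest: inj_onD)
      qed
    qed
    have surj: "\<exists>v\<in>pverts X. v \<noteq> d \<and> s v = t \<and> idx v = x" if "x < card (?C t)" for t x
    proof -
      have "x \<in> idx ` ?C t"
        using bij_betw_imp_surj_on[OF idx[of t]] that by simp
      then show ?thesis by auto
    qed
    have "bij_betw f (pverts X) (pverts (?Y a b))"
    proof (rule bij_betw_imageI[OF inj], intro equalityI subsetI)
      fix z assume "z \<in> f ` pverts X"
      then show "z \<in> pverts (?Y a b)"
        using lt by (fastforce simp: f_def simps split: if_splits)
    next
      fix z assume z: "z \<in> pverts (?Y a b)"
      then consider "z = Inr 0" | y where "z = Inl (Inl y)" "y < a" | y where "z = Inl (Inr y)" "y < b"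
        by (auto simp: simps)
      then show "z \<in> f ` pverts X"
      proof cases
        case 1
        then show ?thesis using d by (force simp: f_def)
      next
        case 2
        then show ?thesis using surj[of y True] by (force simp: f_def a_def)
      next
        case 3
        then show ?thesis using surj[of y False] by (force simp: f_def b_def)
      qed
    qed
    moreover have "(u, v) \<in> parcs X \<longleftrightarrow> (f u, f v) \<in> parcs (?Y a b)"
      if uv: "u \<in> pverts X" "v \<in> pverts X" for u v
    proof (cases "u = v")
      case True
      then show ?thesis
        using no_loops' by (auto simp: f_def simps)
    next
      case False
      then have "f u \<noteq> f v" using inj uv by (auto dest: inj_onD)
      then show ?thesis
        unfolding arc[OF uv False] using False lt[OF uv(1)] lt[OF uv(2)]
        by (auto simp: f_def simps)
    qed
    ultimately have "graph_iso X (?Y a b)"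
      unfolding iso by blast
    then show ?L by blast
  qed
qed

text \<open>Arcs are symmetric, so connected means strongly connected, and the first arc of a walk
  to \<open>v\<close> supplies the neighbour. The main use is to exclude zero vectors from frames,
  since their vertices would be isolated.\<close>

lemma connected_adjacent_vertex:
  assumes "pair_graph X" "Digraph_Component.connected (with_proj X)"
    and "u \<in> pverts X" "v \<in> pverts X" "u \<noteq> v"
  shows "\<exists>w\<in>pverts X. w \<noteq> u \<and> (u, w) \<in> parcs X"
proof -
  interpret pair_graph X by fact
  have "strongly_connected (with_proj X)"
    using symmetric_connected_imp_strongly_connected assms(2) sym_arcs by blast
  then have "u \<rightarrow>\<^sup>*\<^bsub>with_proj X\<^esub> v"
    using assms(3,4) by (auto simp: strongly_connected_def)
  then obtain w where "u \<rightarrow>\<^bsub>with_proj X\<^esub> w"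
    using assms(5) by (cases rule: converse_reachable_cases) auto
  then have "(u, w) \<in> parcs X"
    by (auto simp: arcs_ends_def arc_to_ends_def)
  then show ?thesis
    using wellformed' no_loops' by metis
qed

section \<open>Planar frames\<close>

text \<open>In dimension 1 the vectors are numbers: a zero would isolate its vertex, and nonzero
  numbers have nonzero products.\<close>

lemma frame_representation_1_complete:
  assumes "pair_graph X" "Digraph_Component.connected (with_proj X)"
    and F: "frame_representation X 1 F c"
    and uv: "u \<in> pverts X" "v \<in> pverts X" "u \<noteq> v"
  shows "(u, v) \<in> parcs X"
proof -
  have arc: "(a, b) \<in> parcs X \<longleftrightarrow> F 0 a * F 0 b \<noteq> 0" if "a \<in> pverts X" "b \<in> pverts X" "a \<noteq> b" for a b
    using F that by (simp add: frame_representation_def)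
  have "F 0 u \<noteq> 0"
    using connected_adjacent_vertex[OF assms(1,2) uv] arc uv by force
  moreover have "F 0 v \<noteq> 0"
    using connected_adjacent_vertex[OF assms(1,2) uv(2,1)] arc uv by force
  ultimately show ?thesis using arc[OF uv] by simp
qed

text \<open>The Gram matrix here is the all-ones matrix. From two vertices on, this gives complete
  graphs the bipartition with \<open>i = 1\<close>, so that 2 is not minimal for them.\<close>

lemma complete_frame_representation:
  assumes "\<forall>u\<in>pverts X. \<forall>v\<in>pverts X. u \<noteq> v \<longrightarrow> (u, v) \<in> parcs X"
    and "card (pverts X) > 0"
  shows "frame_representation X 1 (\<lambda>_ _. 1) (card (pverts X))"
  using assms by (simp add: frame_representation_def)

lemma frame_representation_2:
  "frame_representation X 2 F c \<longleftrightarrow> c > 0 \<and>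
     (\<Sum>v\<in>pverts X. F 0 v * F 0 v) = c \<and> (\<Sum>v\<in>pverts X. F 1 v * F 1 v) = c \<and>
     (\<Sum>v\<in>pverts X. F 0 v * F 1 v) = 0 \<and>
     (\<forall>u\<in>pverts X. \<forall>v\<in>pverts X. u \<noteq> v \<longrightarrow>
        ((u, v) \<in> parcs X \<longleftrightarrow> F 0 u * F 0 v + F 1 u * F 1 v \<noteq> 0))"
  by (auto simp: frame_representation_def numeral_2_eq_2 less_Suc_eq mult.commute)

section \<open>Parallel and perpendicular vectors in the plane\<close>

text \<open>The determinant of the two vectors, times either \<open>a\<close> or \<open>b\<close>,
  is a combination of the two inner products.\<close>

lemma perp_perp_imp_parallel:
  fixes a b :: real
  assumes "a \<noteq> 0 \<or> b \<noteq> 0" "x1 * a + y1 * b = 0" "x2 * a + y2 * b = 0"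
  shows "x1 * y2 = y1 * x2"
proof -
  have "a * (x1 * y2 - y1 * x2) = (x1 * a + y1 * b) * y2 - y1 * (x2 * a + y2 * b)"
    by (simp add: algebra_simps)
  moreover have "b * (x1 * y2 - y1 * x2) = x1 * (x2 * a + y2 * b) - x2 * (x1 * a + y1 * b)"
    by (simp add: algebra_simps)
  ultimately show ?thesis
    using assms by auto
qed

text \<open>Turning the first vector by a right angle, to \<open>(y1, - x1)\<close>, exchanges
  parallel and perpendicular.\<close>

lemma parallel_perp_imp_perp:
  fixes a b :: real
  assumes "a \<noteq> 0 \<or> b \<noteq> 0" "x1 * b = y1 * a" "x2 * a + y2 * b = 0"
  shows "x1 * x2 + y1 * y2 = 0"
  using perp_perp_imp_parallel[of a b "y1" "- x1" x2 y2] assms by (simp add: algebra_simps)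

lemma parallel_parallel_imp_parallel:
  fixes a b :: real
  assumes "a \<noteq> 0 \<or> b \<noteq> 0" "x1 * b = y1 * a" "x2 * b = y2 * a"
  shows "x1 * y2 = y1 * x2"
  by (rule perp_perp_imp_parallel[of b "- a"]) (use assms in auto)

text \<open>The two equations are linear in \<open>x\<close> and \<open>y\<close>, with determinant
  \<open>a^2 + b^2\<close>.\<close>

lemma parallel_perp_imp_zero:
  fixes a b :: real
  assumes "x * b = y * a" "x * a + y * b = 0" "a \<noteq> 0 \<or> b \<noteq> 0"
  shows "x = 0" "y = 0"
proof -
  have "x * (a\<^sup>2 + b\<^sup>2) = a * (x * a + y * b) + b * (x * b - y * a)"
    "y * (a\<^sup>2 + b\<^sup>2) = b * (x * a + y * b) - a * (x * b - y * a)"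
    by (simp_all add: algebra_simps power2_eq_square)
  moreover have "a\<^sup>2 + b\<^sup>2 \<noteq> 0" using assms(3) by (simp add: sum_power2_eq_zero_iff)
  ultimately show "x = 0" "y = 0" using assms(1,2) by auto
qed

text \<open>A block collects the vertices whose vectors lie on one of two fixed perpendicular lines; it is
  named by its least vertex \<open>r\<close>, and the sides tell the vectors parallel to that of \<open>r\<close> from those
  perpendicular to it.\<close>

lemma planar_vectors_labelling:
  fixes x y :: "nat \<Rightarrow> real"
  assumes nz: "\<And>v. v \<in> V \<Longrightarrow> x v \<noteq> 0 \<or> y v \<noteq> 0"
  shows "\<exists>(g :: nat \<Rightarrow> nat) (s :: nat \<Rightarrow> bool). \<forall>u\<in>V. \<forall>v\<in>V.
    x u * x v + y u * y v = 0 \<longleftrightarrow> g u = g v \<and> s u \<noteq> s v"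
proof -
  define par where "par u v \<longleftrightarrow> x u * y v = y u * x v" for u v
  define perp where "perp u v \<longleftrightarrow> x u * x v + y u * y v = 0" for u v
  have par_sym: "par u v \<Longrightarrow> par v u" for u v
    by (simp add: par_def mult.commute)
  have perp_sym: "perp u v \<Longrightarrow> perp v u" for u v
    by (simp add: perp_def mult.commute)
  have pp: "par u v" if "perp u w" "perp v w" "w \<in> V" for u v w
    using that(1,2) unfolding par_def perp_def by (rule perp_perp_imp_parallel[OF nz[OF that(3)]])
  have ap: "perp u v" if "par u w" "perp v w" "w \<in> V" for u v w
    using that(1,2) unfolding par_def perp_def by (rule parallel_perp_imp_perp[OF nz[OF that(3)]])
  have aa: "par u v" if "par u w" "par v w" "w \<in> V" for u v w
    using that(1,2) unfolding par_def
    by (rule parallel_parallel_imp_parallel[OF nz[OF that(3)]])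
  have excl: "\<not> (par u v \<and> perp u v)" if "u \<in> V" "v \<in> V" for u v
    using parallel_perp_imp_zero[OF _ _ nz[OF that(2)], of "x u" "y u"] nz[OF that(1)]
    unfolding par_def perp_def by blast
  define rel where "rel u v \<longleftrightarrow> v \<in> V \<and> (par u v \<or> perp u v)" for u v
  define g where "g u = (LEAST w. rel u w)" for u
  define s where "s u = par u (g u)" for u
  have rg: "rel u (g u)" if "u \<in> V" for u
    unfolding g_def by (rule LeastI[of _ u]) (use that in \<open>simp add: rel_def par_def\<close>)
  have "perp u v \<longleftrightarrow> g u = g v \<and> s u \<noteq> s v" if uv: "u \<in> V" "v \<in> V" for u v
  proof
    assume p: "perp u v"
    \<comment> \<open>In the plane, being parallel to one of two perpendicular nonzero vectors is
      being perpendicular to the other, so \<open>u\<close> and \<open>v\<close> have the same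
      candidates for the least representative.\<close>
    have "rel u w \<longleftrightarrow> rel v w" for w
      unfolding rel_def using p pp ap uv perp_sym par_sym by metis
    then have eq: "g u = g v" by (simp add: g_def)
    have r: "rel u (g u)" "rel v (g u)"
      using rg[OF uv(1)] rg[OF uv(2)] eq by auto
    \<comment> \<open>Standing in the same relation to the common representative would make
      \<open>u\<close> and \<open>v\<close> parallel, which \<open>excl\<close> forbids for
      perpendicular nonzero vectors.\<close>
    have "s u \<noteq> s v"
    proof
      assume "s u = s v"
      then have "par u (g u) = par v (g u)" using eq by (simp add: s_def)
      then have "par u v"
        using r aa pp unfolding rel_def by blast
      then show False using excl uv p by blast
    qed
    then show "g u = g v \<and> s u \<noteq> s v" using eq by simp
  next
    assume a: "g u = g v \<and> s u \<noteq> s v"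
    have r: "rel u (g u)" "rel v (g u)"
      using rg[OF uv(1)] rg[OF uv(2)] a by auto
    have "par u (g u) \<noteq> par v (g u)" using a by (auto simp: s_def)
    then show "perp u v"
      using r ap perp_sym unfolding rel_def by blast
  qed
  then show ?thesis
    unfolding perp_def by (intro exI[of _ g] exI[of _ s] ballI)
qed

section \<open>Which labellings have a planar tight frame\<close>

text \<open>Apart from \<open>d\<close>, every vector lies on the line of \<open>u\<close> or on
  that of \<open>v\<close>, and these are perpendicular. Tightness then forces \<open>d\<close> onto
  one of the two lines as well, hence perpendicular to \<open>u\<close> or to \<open>v\<close>,
  although \<open>d\<close> is adjacent to both.\<close>

lemma cone_no_planar_frame:
  assumes fin: "finite (pverts X)" and F: "frame_representation X 2 F c"
    and d: "d \<in> pverts X"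
    and arc: "\<And>u v. u \<in> pverts X \<Longrightarrow> v \<in> pverts X \<Longrightarrow> u \<noteq> v \<Longrightarrow>
      (u, v) \<in> parcs X \<longleftrightarrow> u = d \<or> v = d \<or> s u = (s v :: bool)"
    and uv: "u \<in> pverts X" "v \<in> pverts X" "u \<noteq> v" "(u, v) \<notin> parcs X"
  shows False
proof -
  define x where "x = F 0"
  define y where "y = F 1"
  have sums: "(\<Sum>v\<in>pverts X. x v * x v) = c" "(\<Sum>v\<in>pverts X. y v * y v) = c"
      "(\<Sum>v\<in>pverts X. x v * y v) = 0"
    and adj: "\<And>u v. u \<in> pverts X \<Longrightarrow> v \<in> pverts X \<Longrightarrow> u \<noteq> v \<Longrightarrow>
      (u, v) \<in> parcs X \<longleftrightarrow> x u * x v + y u * y v \<noteq> 0"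
    using F by (auto simp: frame_representation_2 x_def y_def)
  have ne: "u \<noteq> d" "v \<noteq> d" "s u \<noteq> s v"
    using arc uv by auto
  have du: "x d * x u + y d * y u \<noteq> 0" and dv: "x d * x v + y d * y v \<noteq> 0"
    using arc[of d u] arc[of d v] adj[of d u] adj[of d v] uv d ne by auto
  have vnz: "x v \<noteq> 0 \<or> y v \<noteq> 0"
    and unz: "x u \<noteq> 0 \<or> y u \<noteq> 0"
    using du dv by auto
  have perp: "x u * x v + y u * y v = 0"
    using adj uv by blast
  \<comment> \<open>Inner product with \<open>u\<close> times determinant with \<open>u\<close>: up
    to a factor, the sine of the doubled angle between \<open>w\<close> and \<open>u\<close>. It
    vanishes exactly on the lines parallel and perpendicular to \<open>u\<close>.\<close>
  let ?h = "\<lambda>w. (x w * x u + y w * y u) * (x w * y u - y w * x u)"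
  have "?h w = 0" if w: "w \<in> pverts X" "w \<noteq> d" for w
  proof (cases "s w = s u")
    case True
    then have "w \<noteq> v" "(w, v) \<notin> parcs X"
      using arc[of w v] w uv ne by auto
    then have "x w * x v + y w * y v = 0"
      using adj w uv by blast
    then show ?thesis
      using perp_perp_imp_parallel[OF vnz _ perp] by simp
  next
    case False
    then have "w \<noteq> u" "(w, u) \<notin> parcs X"
      using arc[of w u] w uv ne by auto
    then have "x w * x u + y w * y u = 0"
      using adj w uv by blast
    then show ?thesis by simp
  qed
  then have "(\<Sum>w\<in>pverts X - {d}. ?h w) = 0"
    by (intro sum.neutral) blast
  then have "(\<Sum>w\<in>pverts X. ?h w) = ?h d"
    using sum.remove[OF fin d, of ?h] by linarith
  moreover have "(\<Sum>w\<in>pverts X. ?h w) = 0"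
  proof -
    \<comment> \<open>\<open>?h\<close> is a quadratic form of trace 0 in the vector of
      \<open>w\<close>, so its sum over a tight frame vanishes.\<close>
    have "(\<Sum>w\<in>pverts X. ?h w) = (\<Sum>w\<in>pverts X. x u * y u * (x w * x w)
        + ((y u)\<^sup>2 - (x u)\<^sup>2) * (x w * y w) - x u * y u * (y w * y w))"
      by (intro sum.cong refl) (simp add: algebra_simps power2_eq_square)
    also have "\<dots> = x u * y u * c + ((y u)\<^sup>2 - (x u)\<^sup>2) * 0 - x u * y u * c"
      by (simp only: sum_subtractf sum.distrib sum_distrib_left[symmetric] sums)
    finally show ?thesis by simp
  qed
  ultimately have "x d * y u = y d * x u"
    using du by simp
  moreover have "x v * x u + y v * y u = 0"
    using perp by (simp add: mult.commute)
  ultimately have "x d * x v + y d * y v = 0"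
    using parallel_perp_imp_perp[OF unz] by blast
  then show False using dv by simp
qed

text \<open>A vertex in the block of slope \<open>\<tau>\<close> gets a multiple of \<open>(1, \<tau>)\<close> or of \<open>(- \<tau>, 1)\<close>, according to
  its side; \<open>w \<tau>\<close> is the excess of the total squared scale of the first side over the second.\<close>

lemma slopes_frame:
  fixes t :: "'a \<Rightarrow> real" and s :: "'a \<Rightarrow> bool" and w :: "real \<Rightarrow> real"
  assumes fin: "finite (pverts X)" and ne: "pverts X \<noteq> {}"
    and arc: "\<And>u v. u \<in> pverts X \<Longrightarrow> v \<in> pverts X \<Longrightarrow> u \<noteq> v \<Longrightarrow>
      (u, v) \<in> parcs X \<longleftrightarrow> \<not> (t u = t v \<and> s u \<noteq> s v)"
    and noperp: "\<And>u v. u \<in> pverts X \<Longrightarrow> v \<in> pverts X \<Longrightarrow> 1 + t u * t v \<noteq> 0"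
    and bal: "(\<Sum>\<tau>\<in>t ` pverts X. w \<tau> * (1 - \<tau>\<^sup>2)) = 0" "(\<Sum>\<tau>\<in>t ` pverts X. w \<tau> * \<tau>) = 0"
    and wnn: "\<And>\<tau>. w \<tau> \<ge> 0"
    and side: "\<And>v. v \<in> pverts X \<Longrightarrow> \<exists>u\<in>pverts X. t u = t v \<and> \<not> s u"
    and side': "\<And>v. v \<in> pverts X \<Longrightarrow> w (t v) = 0 \<Longrightarrow> \<exists>u\<in>pverts X. t u = t v \<and> s u"
  shows "\<exists>F c. frame_representation X 2 F c"
proof -
  let ?V = "pverts X"
  define C where "C \<tau> b = {v \<in> ?V. t v = \<tau> \<and> s v = b}" for \<tau> b
  \<comment> \<open>The \<open>True\<close> side, if inhabited, gets total squared scale 1 and the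
    other side \<open>w + B\<close>, each spread evenly; the difference is \<open>w\<close> in
    either case. Positivity of \<open>w + B\<close> comes from \<open>wnn\<close> and
    \<open>side'\<close>.\<close>
  define B where "B \<tau> = (if C \<tau> True = {} then 0 else 1 :: real)" for \<tau>
  define q where "q v = (if s v then 1 else w (t v) + B (t v)) / card (C (t v) (s v))" for v
  \<comment> \<open>For \<open>(1, \<tau>)\<close> the pair \<open>(x^2 - y^2, x y)\<close> is
    \<open>(1 - \<tau>^2, \<tau>)\<close>, for \<open>(- \<tau>, 1)\<close> it is the negative;
    \<open>\<sigma>\<close> is this sign, and so the sums in \<open>bal\<close> express
    tightness.\<close>
  define \<sigma> where "\<sigma> v = (if s v then - 1 else 1 :: real)" for v
  have finC: "finite (C \<tau> b)" for \<tau> b using fin by (simp add: C_def)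
  have qpos: "q v > 0" if v: "v \<in> ?V" for v
  proof -
    have "v \<in> C (t v) (s v)" using v by (simp add: C_def)
    then have "card (C (t v) (s v)) > 0" using finC card_gt_0_iff by blast
    moreover have "w (t v) + B (t v) > 0"
    proof (cases "w (t v) = 0")
      case True
      then have "C (t v) True \<noteq> {}" using side'[OF v] by (auto simp: C_def)
      then show ?thesis using True by (simp add: B_def)
    next
      case False
      then show ?thesis using wnn[of "t v"] by (simp add: B_def)
    qed
    ultimately show ?thesis by (simp add: q_def)
  qed
  have class_sum: "(\<Sum>v\<in>{v \<in> ?V. t v = \<tau>}. q v * \<sigma> v) = w \<tau>" if \<tau>: "\<tau> \<in> t ` ?V" for \<tau>
  proof -
    have ne: "C \<tau> False \<noteq> {}" using side \<tau> by (force simp: C_def)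
    have "{v \<in> ?V. t v = \<tau>} = C \<tau> False \<union> C \<tau> True" "C \<tau> False \<inter> C \<tau> True = {}"
      by (auto simp: C_def)
    then have "(\<Sum>v\<in>{v \<in> ?V. t v = \<tau>}. q v * \<sigma> v) =
        (\<Sum>v\<in>C \<tau> False. q v * \<sigma> v) + (\<Sum>v\<in>C \<tau> True. q v * \<sigma> v)"
      using finC by (simp add: sum.union_disjoint)
    also have "(\<Sum>v\<in>C \<tau> False. q v * \<sigma> v) = (\<Sum>v\<in>C \<tau> False. (w \<tau> + B \<tau>) / card (C \<tau> False))"
      by (intro sum.cong refl) (auto simp: C_def q_def \<sigma>_def)
    also have "\<dots> = w \<tau> + B \<tau>" using ne finC by simp
    also have "(\<Sum>v\<in>C \<tau> True. q v * \<sigma> v) = (\<Sum>v\<in>C \<tau> True. - 1 / card (C \<tau> True))"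
      by (intro sum.cong refl) (auto simp: C_def q_def \<sigma>_def)
    also have "\<dots> = - B \<tau>" using finC by (simp add: B_def)
    finally show ?thesis by simp
  qed
  have total: "(\<Sum>v\<in>?V. q v * \<sigma> v * \<phi> (t v)) = (\<Sum>\<tau>\<in>t ` ?V. w \<tau> * \<phi> \<tau>)" for \<phi> :: "real \<Rightarrow> real"
  proof -
    have "(\<Sum>v\<in>?V. q v * \<sigma> v * \<phi> (t v)) =
        (\<Sum>\<tau>\<in>t ` ?V. \<Sum>v\<in>{v \<in> ?V. t v = \<tau>}. q v * \<sigma> v * \<phi> (t v))"
      using fin by (rule sum.image_gen)
    also have "\<dots> = (\<Sum>\<tau>\<in>t ` ?V. w \<tau> * \<phi> \<tau>)"
      by (intro sum.cong refl) (simp add: class_sum[symmetric] sum_distrib_right)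
    finally show ?thesis .
  qed
  define x where "x v = sqrt (q v) * (if s v then - t v else 1)" for v
  define y where "y v = sqrt (q v) * (if s v then 1 else t v)" for v
  define F where "F k = (if k = 0 then x else y)" for k :: nat
  define c where "c = (\<Sum>v\<in>?V. x v * x v)"
  have sq: "(sqrt (q v) * a) * (sqrt (q v) * b) = q v * (a * b)" if "v \<in> ?V" for v a b
  proof -
    have "(sqrt (q v) * a) * (sqrt (q v) * b) = (sqrt (q v) * sqrt (q v)) * (a * b)"
      by (simp only: ac_simps)
    then show ?thesis using qpos[OF that] by simp
  qed
  have xx: "x v * x v = q v * (if s v then (t v)\<^sup>2 else 1)"
    and yy: "y v * y v = q v * (if s v then 1 else (t v)\<^sup>2)"
    and xy: "x v * y v = q v * \<sigma> v * t v" if "v \<in> ?V" for v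
    unfolding x_def y_def sq[OF that] by (auto simp: \<sigma>_def power2_eq_square)
  have "(\<Sum>v\<in>?V. x v * y v) = (\<Sum>v\<in>?V. q v * \<sigma> v * t v)"
    by (intro sum.cong refl xy)
  also have "\<dots> = 0"
    using total[of "\<lambda>\<tau>. \<tau>"] bal(2) by simp
  finally have "(\<Sum>v\<in>?V. x v * y v) = 0" .
  moreover have cy: "(\<Sum>v\<in>?V. y v * y v) = c"
  proof -
    have "c - (\<Sum>v\<in>?V. y v * y v) = (\<Sum>v\<in>?V. x v * x v - y v * y v)"
      by (simp add: c_def sum_subtractf)
    also have "\<dots> = (\<Sum>v\<in>?V. q v * \<sigma> v * (1 - (t v)\<^sup>2))"
      by (intro sum.cong refl) (simp add: xx yy \<sigma>_def algebra_simps)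
    also have "\<dots> = 0"
      using total[of "\<lambda>\<tau>. 1 - \<tau>\<^sup>2"] bal(1) by simp
    finally show ?thesis by simp
  qed
  moreover have "c > 0"
  proof -
    have "2 * c = (\<Sum>v\<in>?V. x v * x v + y v * y v)"
      unfolding sum.distrib cy by (simp add: c_def)
    also have "\<dots> = (\<Sum>v\<in>?V. q v * (1 + (t v)\<^sup>2))"
      by (intro sum.cong refl) (simp add: xx yy algebra_simps)
    also have "\<dots> > 0"
      using fin ne qpos by (intro sum_pos mult_pos_pos) (auto intro: add_pos_nonneg)
    finally show ?thesis by simp
  qed
  moreover have "(u, v) \<in> parcs X \<longleftrightarrow> x u * x v + y u * y v \<noteq> 0"
    if uv: "u \<in> ?V" "v \<in> ?V" "u \<noteq> v" for u v
  proof -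
    have pos: "sqrt (q u) * sqrt (q v) \<noteq> 0"
      using qpos[OF uv(1)] qpos[OF uv(2)] by simp
    \<comment> \<open>Within one side the last factor is nonzero by \<open>noperp\<close>; across
      sides it is a difference of slopes, zero exactly within a block.\<close>
    have "x u * x v + y u * y v = sqrt (q u) * sqrt (q v) *
        (if s u = s v then 1 + t u * t v else if s u then t v - t u else t u - t v)"
      by (auto simp: x_def y_def algebra_simps)
    then have "x u * x v + y u * y v = 0 \<longleftrightarrow> t u = t v \<and> s u \<noteq> s v"
      using pos noperp[OF uv(1,2)] by auto
    then show ?thesis using arc[OF uv] by simp
  qed
  ultimately have "frame_representation X 2 F c"
    by (simp add: frame_representation_2 F_def c_def)
  then show ?thesis by blast
qed

text \<open>The excesses 6, 1, 1 on the slopes 0, 2, -2 balance: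
  \<open>6 (1, 0) + (1 - 4, 2) + (1 - 4, -2) = 0\<close>.\<close>

lemma three_slopes_frame:
  fixes t :: "'a \<Rightarrow> real" and s :: "'a \<Rightarrow> bool"
  assumes fin: "finite (pverts X)"
    and arc: "\<And>u v. u \<in> pverts X \<Longrightarrow> v \<in> pverts X \<Longrightarrow> u \<noteq> v \<Longrightarrow>
      (u, v) \<in> parcs X \<longleftrightarrow> \<not> (t u = t v \<and> s u \<noteq> s v)"
    and three: "{0, 2, -2} \<subseteq> t ` pverts X"
    and range: "\<And>v. v \<in> pverts X \<Longrightarrow> t v \<in> {0, 2, -2} \<or> t v \<ge> 3"
    and side: "\<And>v. v \<in> pverts X \<Longrightarrow> \<exists>u\<in>pverts X. t u = t v \<and> \<not> s u"
    and side': "\<And>v. v \<in> pverts X \<Longrightarrow> t v \<ge> 3 \<Longrightarrow> \<exists>u\<in>pverts X. t u = t v \<and> s u"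
  shows "\<exists>F c. frame_representation X 2 F c"
proof -
  define w :: "real \<Rightarrow> real" where "w \<tau> = (if \<tau> = 0 then 6 else if \<tau> \<in> {2, -2} then 1 else 0)" for \<tau>
  have sum3: "(\<Sum>\<tau>\<in>t ` pverts X. w \<tau> * \<phi> \<tau>) = 6 * \<phi> 0 + \<phi> 2 + \<phi> (-2)" for \<phi>
  proof -
    have "(\<Sum>\<tau>\<in>t ` pverts X. w \<tau> * \<phi> \<tau>) = (\<Sum>\<tau>\<in>{0, 2, -2}. w \<tau> * \<phi> \<tau>)"
      using fin three by (intro sum.mono_neutral_right) (auto simp: w_def)
    then show ?thesis by (simp add: w_def)
  qed
  show ?thesis
  proof (rule slopes_frame[OF fin _ arc, where w = w])
    fix u v assume uv: "u \<in> pverts X" "v \<in> pverts X"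
    \<comment> \<open>Slopes from 3 on are reserved for blocks of weight 0: a nonnegative partner
      gives a nonnegative product, and the partner -2 a product of at most -6.\<close>
    have aux: "1 + a * b \<noteq> 0" if "a \<in> {0, 2, -2} \<or> a \<ge> 3" "b \<ge> 3" for a b :: real
    proof (cases "a \<ge> 0")
      case True
      then show ?thesis using that(2) mult_nonneg_nonneg[of a b] by linarith
    next
      case False
      then show ?thesis using that by auto
    qed
    show "1 + t u * t v \<noteq> 0"
    proof (cases "t v \<ge> 3")
      case True
      then show ?thesis using aux range[OF uv(1)] by blast
    next
      case nv: False
      show ?thesis
      proof (cases "t u \<ge> 3")
        case True
        then show ?thesis using aux[of "t v" "t u"] range[OF uv(2)] by (simp add: mult.commute)
      next
        case False
        then show ?thesis using nv range[OF uv(1)] range[OF uv(2)] by auto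
      qed
    qed
  next
    fix v assume v: "v \<in> pverts X" and "w (t v) = 0"
    then show "\<exists>u\<in>pverts X. t u = t v \<and> s u"
      using range[OF v] side'[OF v] by (auto simp: w_def split: if_splits)
  qed (use three sum3[of "\<lambda>\<tau>. 1 - \<tau>\<^sup>2"] sum3[of "\<lambda>\<tau>. \<tau>"] side in \<open>auto simp: w_def\<close>)
qed

text \<open>\<open>D\<close> collects the dominating vertices; every block outside it has two
  inhabited sides. If \<open>D\<close> is empty, all weights can be 0. Otherwise three slopes must
  carry weight: \<open>D\<close> and two proper blocks provide them, or \<open>D\<close> split in
  two and the only proper block. \<open>nc\<close> yields a proper block, and \<open>ncone\<close> a
  second dominating vertex when there is just one such block.\<close>

lemma labelling_planar_frame:
  fixes g :: "'a \<Rightarrow> nat" and s :: "'a \<Rightarrow> bool"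
  assumes fin: "finite (pverts X)"
    and arc: "\<And>u v. u \<in> pverts X \<Longrightarrow> v \<in> pverts X \<Longrightarrow> u \<noteq> v \<Longrightarrow>
      (u, v) \<in> parcs X \<longleftrightarrow> \<not> (g u = g v \<and> s u \<noteq> s v)"
    and nc: "\<not> (\<forall>u\<in>pverts X. \<forall>v\<in>pverts X. u \<noteq> v \<longrightarrow> (u, v) \<in> parcs X)"
    and ncone: "\<not> (\<exists>d\<in>pverts X. \<exists>s :: 'a \<Rightarrow> bool. \<forall>u\<in>pverts X. \<forall>v\<in>pverts X. u \<noteq> v \<longrightarrow>
       ((u, v) \<in> parcs X \<longleftrightarrow> u = d \<or> v = d \<or> s u = s v))"
  shows "\<exists>F c. frame_representation X 2 F c"
proof -
  let ?V = "pverts X"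
  define D where "D = {v \<in> ?V. \<forall>u\<in>?V. u \<noteq> v \<longrightarrow> (v, u) \<in> parcs X}"
  have DV: "D \<subseteq> ?V" by (auto simp: D_def)
  have sym: "(u, v) \<in> parcs X \<longleftrightarrow> (v, u) \<in> parcs X" if "u \<in> ?V" "v \<in> ?V" "u \<noteq> v" for u v
    using arc[OF that] arc[of v u] that by auto
  have adjD: "(u, v) \<in> parcs X" if "u \<in> ?V" "v \<in> ?V" "u \<noteq> v" "u \<in> D \<or> v \<in> D" for u v
    using that sym by (auto simp: D_def)
  have opp: "\<exists>u\<in>?V - D. g u = g v \<and> s u = (\<not> s v)" if v: "v \<in> ?V" "v \<notin> D" for v
  proof -
    obtain u where u: "u \<in> ?V" "u \<noteq> v" "(v, u) \<notin> parcs X"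
      using v by (auto simp: D_def)
    then have "u \<notin> D" using adjD v by blast
    then show ?thesis using u arc[of v u] v by auto
  qed
  have sides: "\<exists>u\<in>?V - D. g u = g v \<and> s u = b" if v: "v \<in> ?V" "v \<notin> D" for v b
  proof (cases "s v = b")
    case True
    then show ?thesis using v by blast
  next
    case False
    then show ?thesis using opp[OF v] by auto
  qed
  obtain p p' where "p \<in> ?V" "p' \<in> ?V" "p \<noteq> p'" "(p, p') \<notin> parcs X"
    using nc by blast
  then have p: "p \<in> ?V" "p \<notin> D"
    by (auto simp: D_def)
  consider "D = {}" | q where "D \<noteq> {}" "q \<in> ?V" "q \<notin> D" "g q \<noteq> g p"
    | "D \<noteq> {}" "\<forall>q\<in>?V - D. g q = g p" by blast
  then show ?thesis
  proof cases
    case 1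
    show ?thesis
    \<comment> \<open>Labels are nonnegative, so as slopes no two of them are perpendicular; weight
      0 everywhere is trivially balanced.\<close>
    proof (rule slopes_frame[OF fin, where t = "\<lambda>v. real (g v)" and s = s and w = "\<lambda>_. 0"])
      show "?V \<noteq> {}" using p by auto
      show "1 + real (g u) * real (g v) \<noteq> 0" for u v
      proof -
        have "0 \<le> real (g u) * real (g v)" by simp
        then show ?thesis by linarith
      qed
      show "\<exists>u\<in>?V. real (g u) = real (g v) \<and> \<not> s u"
        "\<exists>u\<in>?V. real (g u) = real (g v) \<and> s u" if "v \<in> ?V" for v
        using sides[of v False] sides[of v True] that 1 by auto
    qed (use arc in auto)
  next
    case (2 q)
    \<comment> \<open>All dominating vertices share slope 0. The offset 3 keeps the remaining blocks
      apart from one another and from 0, 2 and -2.\<close>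
    define t where "t v = (if v \<in> D then 0 else if g v = g p then 2 else if g v = g q then -2
      else 3 + real (g v))" for v
    \<comment> \<open>Whatever their original side, dominating vertices go to the
      \<open>False\<close> side, the one that must be inhabited.\<close>
    define s' where "s' v \<longleftrightarrow> s v \<and> v \<notin> D" for v
    have teq: "t u = t v \<longleftrightarrow> g u = g v" if "u \<notin> D" "v \<notin> D" for u v
      using that by (auto simp: t_def)
    have t0: "t v = 0 \<longleftrightarrow> v \<in> D" for v
      by (auto simp: t_def)
    have side: "\<exists>u\<in>?V. t u = t v \<and> s' u = b" if v: "v \<in> ?V" "v \<notin> D" for v b
    proof -
      obtain u where "u \<in> ?V - D" "g u = g v" "s u = b" using sides[OF v] by blast
      then show ?thesis using teq[of u v] v by (intro bexI[of _ u]) (auto simp: s'_def)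
    qed
    show ?thesis
    proof (rule three_slopes_frame[OF fin, where t = t and s = s'])
      fix u v assume uv: "u \<in> ?V" "v \<in> ?V" "u \<noteq> v"
      show "(u, v) \<in> parcs X \<longleftrightarrow> \<not> (t u = t v \<and> s' u \<noteq> s' v)"
      proof (cases "u \<in> D \<or> v \<in> D")
        case True
        then have "\<not> (t u = t v \<and> s' u \<noteq> s' v)"
          using t0[of u] t0[of v] by (auto simp: s'_def)
        then show ?thesis using adjD[OF uv True] by blast
      next
        case False
        then show ?thesis using arc[OF uv] teq[of u v] by (simp add: s'_def)
      qed
    next
      obtain d where "d \<in> D" using 2(1) by blast
      then have "t d = 0" "t p = 2" "t q = -2" "d \<in> ?V"
        using p 2 DV by (auto simp: t_def)
      then show "{0, 2, -2} \<subseteq> t ` ?V"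
        using p(1) 2(2) by (auto intro: rev_image_eqI)
    next
      fix v assume v: "v \<in> ?V"
      show "t v \<in> {0, 2, -2} \<or> t v \<ge> 3" by (auto simp: t_def)
      show "\<exists>u\<in>?V. t u = t v \<and> \<not> s' u"
        using side[OF v, of False] v by (cases "v \<in> D") (auto simp: s'_def)
      assume "t v \<ge> 3"
      then have "v \<notin> D" using t0[of v] by auto
      then show "\<exists>u\<in>?V. t u = t v \<and> s' u" using side[OF v, of True] by auto
    qed
  next
    case 3
    obtain d where d: "d \<in> D" using 3(1) by blast
    have "\<exists>e\<in>D. e \<noteq> d"
    proof (rule ccontr)
      assume "\<not> ?thesis"
      then have D: "D = {d}" using d by blast
      have "(u, v) \<in> parcs X \<longleftrightarrow> u = d \<or> v = d \<or> s u = s v"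
        if uv: "u \<in> ?V" "v \<in> ?V" "u \<noteq> v" for u v
      proof (cases "u = d \<or> v = d")
        case True
        then show ?thesis using adjD[OF uv] D by auto
      next
        case False
        then have "g u = g v" using 3(2) uv D by auto
        then show ?thesis using arc[OF uv] False by simp
      qed
      then have "\<exists>d\<in>?V. \<exists>s. \<forall>u\<in>?V. \<forall>v\<in>?V. u \<noteq> v \<longrightarrow>
          ((u, v) \<in> parcs X \<longleftrightarrow> u = d \<or> v = d \<or> s u = (s v :: bool))"
        using d DV by (intro bexI[of _ d] exI[of _ s] ballI impI) auto
      then show False using ncone by (rule notE[rotated])
    qed
    then obtain e where e: "e \<in> D" "e \<noteq> d" by blast
    \<comment> \<open>The only proper block takes slope -2, so the dominating vertices have to cover
      the other two: \<open>d\<close> takes 0, and the rest, among them \<open>e\<close>, take 2. No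
      block of weight 0 is left.\<close>
    define t where "t v = (if v = d then 0 else if v \<in> D then 2 else -2 :: real)" for v
    define s' where "s' v \<longleftrightarrow> s v \<and> v \<notin> D" for v
    show ?thesis
    proof (rule three_slopes_frame[OF fin, where t = t and s = s'])
      fix u v assume uv: "u \<in> ?V" "v \<in> ?V" "u \<noteq> v"
      show "(u, v) \<in> parcs X \<longleftrightarrow> \<not> (t u = t v \<and> s' u \<noteq> s' v)"
      proof (cases "u \<in> D \<or> v \<in> D")
        case True
        then have "\<not> (t u = t v \<and> s' u \<noteq> s' v)"
          using d by (auto simp: s'_def t_def split: if_splits)
        then show ?thesis using adjD[OF uv True] by blast
      next
        case False
        moreover have "g u = g v" using False 3(2) uv by auto
        moreover have "t u = t v" using False d by (auto simp: t_def)
        ultimately show ?thesis using arc[OF uv] by (simp add: s'_def)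
      qed
    next
      have "t d = 0" "t e = 2" "t p = -2" "d \<in> ?V" "e \<in> ?V"
        using d e p DV by (auto simp: t_def)
      then show "{0, 2, -2} \<subseteq> t ` ?V"
        using p(1) by (auto intro: rev_image_eqI)
    next
      fix v assume v: "v \<in> ?V"
      show "t v \<in> {0, 2, -2} \<or> t v \<ge> 3" by (auto simp: t_def)
      show "\<exists>u\<in>?V. t u = t v \<and> \<not> s' u"
      proof (cases "v \<in> D")
        case True
        then show ?thesis using v by (auto simp: s'_def)
      next
        case False
        then obtain u where "u \<in> ?V - D" "\<not> s u" using sides[OF v False, of False] by blast
        moreover from this have "t u = t v" using False d by (auto simp: t_def)
        ultimately show ?thesis by (auto simp: s'_def)
      qed
      assume "t v \<ge> 3"
      then show "\<exists>u\<in>?V. t u = t v \<and> s' u" by (auto simp: t_def split: if_splits)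
    qed
  qed
qed

theorem theorem1p2:
  fixes X :: "nat pair_pre_digraph" and n :: nat
  assumes "pair_graph X"
    and "pverts X = {0..<n}"
    and "Digraph_Component.connected (with_proj X)"
  shows "minimal_multiplicity_bipartition X (n - 2) 2 \<longleftrightarrow>
    (\<exists>(k::nat) (a :: nat \<Rightarrow> nat) (b :: nat \<Rightarrow> nat). k > 1 \<and>
       graph_iso X
         (graph_joins k (\<lambda>i. graph_union (complete_graph (a i)) (complete_graph (b i))))) \<and>
    \<not> (\<exists>m. graph_iso X (complete_graph m)) \<and>
    \<not> (\<exists>a b. graph_iso X
         (graph_join (graph_union (complete_graph a) (complete_graph b)) (complete_graph 1)))"
  unfolding graph_iso_complete_graph_iff[OF assms(1)] graph_iso_joins_iff[OF assms(1)]
    graph_iso_cone_iff[OF assms(1)]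
proof (intro iffI conjI)
  let ?complete = "\<forall>u\<in>pverts X. \<forall>v\<in>pverts X. u \<noteq> v \<longrightarrow> (u, v) \<in> parcs X"
  assume min: "minimal_multiplicity_bipartition X (n - 2) 2"
  then have mb: "multiplicity_bipartition X (n - 2) 2"
    and least: "\<And>q j. multiplicity_bipartition X q j \<Longrightarrow> 2 \<le> j"
    by (auto simp: minimal_multiplicity_bipartition_def)
  have n: "n \<ge> 3"
    using mb assms(2) by (auto simp: multiplicity_bipartition_def)
  obtain F where F: "frame_representation X 2 F 1"
    using multiplicity_bipartition_imp_frame[OF assms(2) mb] by blast
  have arc: "(u, v) \<in> parcs X \<longleftrightarrow> F 0 u * F 0 v + F 1 u * F 1 v \<noteq> 0"
    if "u \<in> pverts X" "v \<in> pverts X" "u \<noteq> v" for u v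
    using F that by (simp add: frame_representation_2)
  have nz: "F 0 v \<noteq> 0 \<or> F 1 v \<noteq> 0" if v: "v \<in> pverts X" for v
  proof -
    obtain u where "u \<in> pverts X" "u \<noteq> v"
      using that[of "if v = 0 then 1 else 0"] n assms(2) by (auto split: if_splits)
    then obtain w where "w \<in> pverts X" "w \<noteq> v" "(v, w) \<in> parcs X"
      using connected_adjacent_vertex[OF assms(1,3) v] by metis
    then show ?thesis using arc[of v w] v by auto
  qed
  have "\<exists>(g :: nat \<Rightarrow> nat) (s :: nat \<Rightarrow> bool). \<forall>u\<in>pverts X. \<forall>v\<in>pverts X.
      F 0 u * F 0 v + F 1 u * F 1 v = 0 \<longleftrightarrow> g u = g v \<and> s u \<noteq> s v"
    using nz by (rule planar_vectors_labelling)
  then obtain g :: "nat \<Rightarrow> nat" and s :: "nat \<Rightarrow> bool" where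
    "\<forall>u\<in>pverts X. \<forall>v\<in>pverts X.
      F 0 u * F 0 v + F 1 u * F 1 v = 0 \<longleftrightarrow> g u = g v \<and> s u \<noteq> s v"
    by (elim exE)
  then show "\<exists>(g :: nat \<Rightarrow> nat) (s :: nat \<Rightarrow> bool). \<forall>u\<in>pverts X. \<forall>v\<in>pverts X. u \<noteq> v \<longrightarrow>
      ((u, v) \<in> parcs X \<longleftrightarrow> \<not> (g u = g v \<and> s u \<noteq> s v))"
    using arc by (intro exI[of _ g] exI[of _ s]) auto
  show nc: "\<not> ?complete"
  proof
    assume ?complete
    then have "frame_representation X 1 (\<lambda>_ _. 1) (real n)"
      using complete_frame_representation[of X] assms(2) n by simp
    then have "multiplicity_bipartition X (n - 1) 1"
      using frame_imp_multiplicity_bipartition[OF assms(2)] n by simp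
    then show False using least by fastforce
  qed
  show "\<not> (\<exists>d\<in>pverts X. \<exists>s :: nat \<Rightarrow> bool. \<forall>u\<in>pverts X. \<forall>v\<in>pverts X. u \<noteq> v \<longrightarrow>
       ((u, v) \<in> parcs X \<longleftrightarrow> u = d \<or> v = d \<or> s u = s v))"
  proof
    assume "\<exists>d\<in>pverts X. \<exists>s :: nat \<Rightarrow> bool. \<forall>u\<in>pverts X. \<forall>v\<in>pverts X. u \<noteq> v \<longrightarrow>
       ((u, v) \<in> parcs X \<longleftrightarrow> u = d \<or> v = d \<or> s u = s v)"
    then obtain d and s :: "nat \<Rightarrow> bool" where d: "d \<in> pverts X"
      and cone: "\<forall>u\<in>pverts X. \<forall>v\<in>pverts X. u \<noteq> v \<longrightarrow>
        ((u, v) \<in> parcs X \<longleftrightarrow> u = d \<or> v = d \<or> s u = s v)" by (elim bexE exE)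
    obtain u v where "u \<in> pverts X" "v \<in> pverts X" "u \<noteq> v" "(u, v) \<notin> parcs X"
      using nc by blast
    then show False
      using cone by (intro cone_no_planar_frame[OF _ F d, of s u v]) (auto simp: assms(2))
  qed
next
  let ?complete = "\<forall>u\<in>pverts X. \<forall>v\<in>pverts X. u \<noteq> v \<longrightarrow> (u, v) \<in> parcs X"
  assume asm: "(\<exists>(g :: nat \<Rightarrow> nat) (s :: nat \<Rightarrow> bool). \<forall>u\<in>pverts X. \<forall>v\<in>pverts X. u \<noteq> v \<longrightarrow>
      ((u, v) \<in> parcs X \<longleftrightarrow> \<not> (g u = g v \<and> s u \<noteq> s v))) \<and>
    \<not> ?complete \<and> \<not> (\<exists>d\<in>pverts X. \<exists>s :: nat \<Rightarrow> bool. \<forall>u\<in>pverts X. \<forall>v\<in>pverts X. u \<noteq> v \<longrightarrow>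
       ((u, v) \<in> parcs X \<longleftrightarrow> u = d \<or> v = d \<or> s u = s v))"
  then obtain g s where gs: "\<forall>u\<in>pverts X. \<forall>v\<in>pverts X. u \<noteq> v \<longrightarrow>
      ((u, v) \<in> parcs X \<longleftrightarrow> \<not> (g u = (g v :: nat) \<and> s u \<noteq> (s v :: bool)))"
    by (elim conjE exE)
  have fin: "finite (pverts X)" by (simp add: assms(2))
  have "\<exists>F c. frame_representation X 2 F c"
  proof (rule labelling_planar_frame[OF fin, of g s])
    show "(u, v) \<in> parcs X \<longleftrightarrow> \<not> (g u = g v \<and> s u \<noteq> s v)"
      if "u \<in> pverts X" "v \<in> pverts X" "u \<noteq> v" for u v
      using gs that by (elim ballE[of _ _ u] ballE[of _ _ v]) simp_all
  qed (rule asm[THEN conjunct2, THEN conjunct1] asm[THEN conjunct2, THEN conjunct2])+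
  then obtain F c where F: "frame_representation X 2 F c" by blast
  obtain u v where uv: "u \<in> pverts X" "v \<in> pverts X" "u \<noteq> v" "(u, v) \<notin> parcs X"
    using asm[THEN conjunct2, THEN conjunct1] by blast
  \<comment> \<open>A neighbour of \<open>u\<close> is a third vertex besides the nonadjacent
    \<open>u\<close> and \<open>v\<close>, which gives \<open>2 \<le> n - 1\<close>.\<close>
  obtain w where "w \<in> pverts X" "w \<noteq> u" "(u, w) \<in> parcs X"
    using connected_adjacent_vertex[OF assms(1,3) uv(1-3)] by blast
  moreover from this have "w \<noteq> v" using uv(4) by blast
  ultimately have n: "n \<ge> 3" using uv(1-3) unfolding assms(2) by auto
  then have "multiplicity_bipartition X (n - 2) 2"
    using frame_imp_multiplicity_bipartition[OF assms(2) _ _ F] by simp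
  \<comment> \<open>The value 0 is excluded by definition, and \<open>j = 1\<close> would make
    \<open>X\<close> complete.\<close>
  moreover have "2 \<le> j" if mb: "multiplicity_bipartition X q j" for q j
  proof (rule ccontr)
    assume "\<not> 2 \<le> j"
    then have "j = 1"
      using mb by (auto simp: multiplicity_bipartition_def)
    then obtain F' where "frame_representation X 1 F' 1"
      using multiplicity_bipartition_imp_frame[OF assms(2) mb] by auto
    then show False
      using frame_representation_1_complete[OF assms(1,3) _ uv(1-3)] uv(4) by blast
  qed
  ultimately show "minimal_multiplicity_bipartition X (n - 2) 2"
    by (auto simp: minimal_multiplicity_bipartition_def)
qed

end
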